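(* Let $G\prec\mathcal{G}$ be a small model and let $\delta:S_{x}^{\mathrm{inv}}(\mathcal{G},G) \to \mathfrak{M}_{x}^{\mathrm{inv}}(\mathcal{G},G)$ be the map $\delta(p) = \delta_{p}$. Then $\delta$ is a topological embedding, and $\delta_{p * q} = \delta_{p} * \delta_{q}$ for any $p,q \in S_x^{\mathrm{inv}}(\mathcal{G},G)$.
   Context: Setting: $T$ is an arbitrary first-order theory in a language $\mathcal{L}$ expanding a group, $\mathcal{G}$ is a sufficiently saturated (monster) model of $T$, and "small" means small relative to the saturation of $\mathcal{G}$. The variable $x$ (and $y$ in convolutions) is a singleton variable of the sort on which the group is defined. Keisler measures: for $A\subseteq\mathcal{G}$, $\mathcal{L}_x(A)$ is the Boolean algebra of formulas in $x$ with parameters from $A$ (up to equivalence), $S_x(A)$ is the space of types over $A$, and $\mathfrak{M}_x(A)$ is the set of Keisler measures over $A$, i.e. finitely additive probability measures on $\mathcal{L}_x(A)$, with the topology induced from $[0,1]^{\mathcal{L}_x(A)}$; each is identified with the corresponding regular Borel probability measure on $S_x(A)$. $\mu|_A$ denotes restriction, and $\delta_p$ is the Dirac measure at the type $p$. The support of $\mu\in\mathfrak{M}_x(A)$ is $S(\mu)=\{p\in S_x(A):\mu(\varphi(x))>0 \text{ for all }\varphi(x)\in p\}$. $S_x^{\mathrm{inv}}(\mathcal{G},G)\subseteq S_x(\mathcal{G})$ is the closed set of $G$-invariant global types and $\mathfrak{M}^{\mathrm{inv}}_x(\mathcal{G},G)\subseteq\mathfrak{M}_x(\mathcal{G})$ the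 closed set of $G$-invariant global measures ($\mu(\varphi(x;b))=\mu(\varphi(x;b'))$ whenever $b\equiv_G b'$ and $\varphi(x;y)\in\mathcal{L}(G)$). Product of types: for $p,q\in S_x^{\mathrm{inv}}(\mathcal{G},G)$, $p*q:=\mathrm{tp}(a\cdot b/\mathcal{G})\in S_x^{\mathrm{inv}}(\mathcal{G},G)$, where (in a larger monster model) $b\models q$ and $a$ realizes the restriction to $\mathcal{G}b$ of the unique $G$-invariant extension of $p$. Convolution of measures: for $\mu,\nu\in\mathfrak{M}_x(\mathcal{G})$ let $\nu_y$ be $\nu$ viewed as a measure in the variable $y$. The pair $(\mu,\nu)$ is $*$-Borel if for every $\varphi(x,\bar c)\in\mathcal{L}_x(\mathcal{G})$ there is a small $N\prec\mathcal{G}$ containing $\bar c$ such that for every $r\in S(\nu_y|_N)$ the value $F(r):=\mu(\varphi(x\cdot d,\bar c))$ is the same for all $d\models r$ in $\mathcal{G}$, and $F:S(\nu_y|_N)\to[0,1]$ is Borel. Then $(\mu*\nu)(\varphi(x,\bar c)):=\int_{S(\nu_y|_N)}F\,d\nu_N$, where $\nu_N$ is the Borel measure $\nu_y|_N$ restricted to its support (this does not depend on $N$). *)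

theory Defs
  imports "HOL-Probability.Probability" "HOL-Algebra.Group"
begin

section \<open>Many-sorted first-order logic with parameters\<close>

text \<open>
  Languages are many-sorted (every element of the type \<open>'s\<close> is a sort; the one-sorted case is
  \<open>'s = unit\<close>). A function or relation symbol belongs to the language iff its signature is not
  \<^term>\<open>None\<close>. The fields \<open>gsort\<close> and \<open>gmul\<close> name the sort carrying the group and
  the symbol for its multiplication. Identity and inverse need not be symbols of the language
  (but may be).
\<close>

record ('s, 'f, 'r) lang =
  fun_sig :: "'f \<Rightarrow> ('s list \<times> 's) option"
  rel_sig :: "'r \<Rightarrow> 's list option"
  gsort :: 's
  gmul :: 'f

text \<open>The sorts of a structure are the (disjoint) fibres of \<open>sort_of\<close> on its universe.\<close>

record ('s, 'f, 'r, 'a) model =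
  univ :: "'a set"
  sort_of :: "'a \<Rightarrow> 's"
  fun_int :: "'f \<Rightarrow> 'a list \<Rightarrow> 'a"
  rel_int :: "'r \<Rightarrow> 'a list \<Rightarrow> bool"

definition Dom :: "('s, 'f, 'r, 'a) model \<Rightarrow> 's \<Rightarrow> 'a set" where
  "Dom M s = {a \<in> univ M. sort_of M a = s}"

definition is_model :: "('s, 'f, 'r) lang \<Rightarrow> ('s, 'f, 'r, 'a) model \<Rightarrow> bool" where
  "is_model L M \<longleftrightarrow>
     (\<forall>s. Dom M s \<noteq> {}) \<and>
     (\<forall>f ss s as. fun_sig L f = Some (ss, s) \<longrightarrow> list_all2 (\<lambda>a t. a \<in> Dom M t) as ss
        \<longrightarrow> fun_int M f as \<in> Dom M s)"

text \<open>
  Variables are de Bruijn indices and \<open>Par a\<close> is the constant symbol naming the element \<open>a\<close>.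
\<close>

datatype ('f, 'a) tm = Var nat | Par 'a | App 'f "('f, 'a) tm list"

datatype ('s, 'f, 'r, 'a) fm =
    Fls
  | Eql "('f, 'a) tm" "('f, 'a) tm"
  | Atom 'r "('f, 'a) tm list"
  | Neg "('s, 'f, 'r, 'a) fm"
  | And "('s, 'f, 'r, 'a) fm" "('s, 'f, 'r, 'a) fm"
  | Exi 's "('s, 'f, 'r, 'a) fm"

definition Or :: "('s, 'f, 'r, 'a) fm \<Rightarrow> ('s, 'f, 'r, 'a) fm \<Rightarrow> ('s, 'f, 'r, 'a) fm" where
  "Or \<phi> \<psi> = Neg (And (Neg \<phi>) (Neg \<psi>))"

text \<open>
  Well-sortedness with parameters from \<open>A\<close>; the list \<open>\<Gamma>\<close> gives the sorts of the free variables
  \<open>0, 1, \<dots>, length \<Gamma> - 1\<close>.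
\<close>

inductive has_sort ::
  "('s, 'f, 'r) lang \<Rightarrow> ('s, 'f, 'r, 'a) model \<Rightarrow> 'a set \<Rightarrow> 's list \<Rightarrow> ('f, 'a) tm \<Rightarrow> 's \<Rightarrow> bool"
  for L M A \<Gamma> where
    has_sort_Var: "i < length \<Gamma> \<Longrightarrow> has_sort L M A \<Gamma> (Var i) (\<Gamma> ! i)"
  | has_sort_Par: "a \<in> A \<Longrightarrow> a \<in> univ M \<Longrightarrow> has_sort L M A \<Gamma> (Par a) (sort_of M a)"
  | has_sort_App: "fun_sig L f = Some (ss, s) \<Longrightarrow> list_all2 (has_sort L M A \<Gamma>) ts ss
      \<Longrightarrow> has_sort L M A \<Gamma> (App f ts) s"

primrec wf_fm ::
  "('s, 'f, 'r) lang \<Rightarrow> ('s, 'f, 'r, 'a) model \<Rightarrow> 'a set \<Rightarrow> 's list \<Rightarrow> ('s, 'f, 'r, 'a) fm \<Rightarrow> bool"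
  where
    "wf_fm L M A \<Gamma> Fls \<longleftrightarrow> True"
  | "wf_fm L M A \<Gamma> (Eql t u) \<longleftrightarrow> (\<exists>s. has_sort L M A \<Gamma> t s \<and> has_sort L M A \<Gamma> u s)"
  | "wf_fm L M A \<Gamma> (Atom r ts) \<longleftrightarrow>
       (\<exists>ss. rel_sig L r = Some ss \<and> list_all2 (has_sort L M A \<Gamma>) ts ss)"
  | "wf_fm L M A \<Gamma> (Neg \<phi>) \<longleftrightarrow> wf_fm L M A \<Gamma> \<phi>"
  | "wf_fm L M A \<Gamma> (And \<phi> \<psi>) \<longleftrightarrow> wf_fm L M A \<Gamma> \<phi> \<and> wf_fm L M A \<Gamma> \<psi>"
  | "wf_fm L M A \<Gamma> (Exi s \<phi>) \<longleftrightarrow> wf_fm L M A (s # \<Gamma>) \<phi>"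

definition fmls ::
  "('s, 'f, 'r) lang \<Rightarrow> ('s, 'f, 'r, 'a) model \<Rightarrow> 'a set \<Rightarrow> 's list \<Rightarrow> ('s, 'f, 'r, 'a) fm set" where
  "fmls L M A \<Gamma> = {\<phi>. wf_fm L M A \<Gamma> \<phi>}"

primrec tm_val :: "('s, 'f, 'r, 'a) model \<Rightarrow> (nat \<Rightarrow> 'a) \<Rightarrow> ('f, 'a) tm \<Rightarrow> 'a" where
    "tm_val M v (Var i) = v i"
  | "tm_val M v (Par a) = a"
  | "tm_val M v (App f ts) = fun_int M f (map (tm_val M v) ts)"

primrec sat :: "('s, 'f, 'r, 'a) model \<Rightarrow> (nat \<Rightarrow> 'a) \<Rightarrow> ('s, 'f, 'r, 'a) fm \<Rightarrow> bool" where
    "sat M v Fls \<longleftrightarrow> False"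
  | "sat M v (Eql t u) \<longleftrightarrow> tm_val M v t = tm_val M v u"
  | "sat M v (Atom r ts) \<longleftrightarrow> rel_int M r (map (tm_val M v) ts)"
  | "sat M v (Neg \<phi>) \<longleftrightarrow> \<not> sat M v \<phi>"
  | "sat M v (And \<phi> \<psi>) \<longleftrightarrow> sat M v \<phi> \<and> sat M v \<psi>"
  | "sat M v (Exi s \<phi>) \<longleftrightarrow> (\<exists>a \<in> Dom M s. sat M (case_nat a v) \<phi>)"

text \<open>Satisfaction by a finite tuple; only indices below its length matter for the formulas used.\<close>

definition sat_tup :: "('s, 'f, 'r, 'a) model \<Rightarrow> 'a list \<Rightarrow> ('s, 'f, 'r, 'a) fm \<Rightarrow> bool" where
  "sat_tup M as \<phi> \<longleftrightarrow> sat M ((!) as) \<phi>"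

primrec subst_tm :: "(nat \<Rightarrow> ('f, 'a) tm) \<Rightarrow> ('f, 'a) tm \<Rightarrow> ('f, 'a) tm" where
    "subst_tm \<sigma> (Var i) = \<sigma> i"
  | "subst_tm \<sigma> (Par a) = Par a"
  | "subst_tm \<sigma> (App f ts) = App f (map (subst_tm \<sigma>) ts)"

text \<open>Simultaneous capture-avoiding substitution.\<close>

primrec subst_fm ::
  "(nat \<Rightarrow> ('f, 'a) tm) \<Rightarrow> ('s, 'f, 'r, 'a) fm \<Rightarrow> ('s, 'f, 'r, 'a) fm" where
    "subst_fm \<sigma> Fls = Fls"
  | "subst_fm \<sigma> (Eql t u) = Eql (subst_tm \<sigma> t) (subst_tm \<sigma> u)"
  | "subst_fm \<sigma> (Atom r ts) = Atom r (map (subst_tm \<sigma>) ts)"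
  | "subst_fm \<sigma> (Neg \<phi>) = Neg (subst_fm \<sigma> \<phi>)"
  | "subst_fm \<sigma> (And \<phi> \<psi>) = And (subst_fm \<sigma> \<phi>) (subst_fm \<sigma> \<psi>)"
  | "subst_fm \<sigma> (Exi s \<phi>) =
       Exi s (subst_fm (case_nat (Var 0) (\<lambda>i. subst_tm (\<lambda>j. Var (Suc j)) (\<sigma> i))) \<phi>)"

text \<open>\<open>elem_sub L N M\<close> is \<open>N \<prec> M\<close>.\<close>

definition elem_sub ::
  "('s, 'f, 'r) lang \<Rightarrow> ('s, 'f, 'r, 'a) model \<Rightarrow> ('s, 'f, 'r, 'a) model \<Rightarrow> bool" where
  "elem_sub L N M \<longleftrightarrow>
     is_model L N \<and> is_model L M \<and> univ N \<subseteq> univ M \<and>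
     (\<forall>a \<in> univ N. sort_of N a = sort_of M a) \<and>
     (\<forall>as \<in> lists (univ N). \<forall>\<phi> \<in> fmls L M {} (map (sort_of M) as).
        sat_tup N as \<phi> \<longleftrightarrow> sat_tup M as \<phi>)"

text \<open>\<open>tup_equiv L M A bs bs'\<close> is \<open>bs \<equiv>\<^sub>A bs'\<close>.\<close>

definition tup_equiv ::
  "('s, 'f, 'r) lang \<Rightarrow> ('s, 'f, 'r, 'a) model \<Rightarrow> 'a set \<Rightarrow> 'a list \<Rightarrow> 'a list \<Rightarrow> bool" where
  "tup_equiv L M A bs bs' \<longleftrightarrow>
     map (sort_of M) bs = map (sort_of M) bs' \<and>
     (\<forall>\<psi> \<in> fmls L M A (map (sort_of M) bs). sat_tup M bs \<psi> \<longleftrightarrow> sat_tup M bs' \<psi>)"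

text \<open>\<open>\<phi>(x; bs)\<close>, where \<open>x\<close> is variable \<open>0\<close> of \<open>\<phi>\<close> and the remaining ones are replaced by \<open>bs\<close>.\<close>

definition inst_pars :: "'a list \<Rightarrow> ('s, 'f, 'r, 'a) fm \<Rightarrow> ('s, 'f, 'r, 'a) fm" where
  "inst_pars bs \<phi> = subst_fm (case_nat (Var 0) (\<lambda>i. Par (bs ! i))) \<phi>"

text \<open>\<open>\<phi>(x \<cdot> d)\<close>, for \<open>\<phi>\<close> whose only free variable is \<open>0\<close>.\<close>

definition translate ::
  "('s, 'f, 'r) lang \<Rightarrow> 'a \<Rightarrow> ('s, 'f, 'r, 'a) fm \<Rightarrow> ('s, 'f, 'r, 'a) fm" where
  "translate L d \<phi> = subst_fm (\<lambda>_. App (gmul L) [Var 0, Par d]) \<phi>"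


section \<open>Types and monster models\<close>

definition types ::
  "('s, 'f, 'r) lang \<Rightarrow> ('s, 'f, 'r, 'a) model \<Rightarrow> 's \<Rightarrow> 'a set \<Rightarrow> ('s, 'f, 'r, 'a) fm set set" where
  "types L M s A =
     {p. p \<subseteq> fmls L M A [s] \<and>
         (\<forall>F \<subseteq> p. finite F \<longrightarrow> (\<exists>a \<in> Dom M s. \<forall>\<phi> \<in> F. sat_tup M [a] \<phi>)) \<and>
         (\<forall>\<phi> \<in> fmls L M A [s]. \<phi> \<in> p \<or> Neg \<phi> \<in> p)}"

definition realizations ::
  "('s, 'f, 'r, 'a) model \<Rightarrow> 's \<Rightarrow> ('s, 'f, 'r, 'a) fm set \<Rightarrow> 'a set" where
  "realizations M s p = {a \<in> Dom M s. \<forall>\<phi> \<in> p. sat_tup M [a] \<phi>}"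

definition small :: "'k rel \<Rightarrow> 'b set \<Rightarrow> bool" where
  "small \<kappa> A \<longleftrightarrow> (card_of A, \<kappa>) \<in> ordLess"

text \<open>
  A monster model of \<open>T\<close>: a \<open>\<kappa>\<close>-saturated model of \<open>T\<close> with \<open>\<kappa> > |L|\<close>, where \<open>|L|\<close> is the
  number of \<open>L\<close>-formulas (hence \<open>\<kappa>\<close> is uncountable).
\<close>

definition monster ::
  "('s, 'f, 'r) lang \<Rightarrow> ('s, 'f, 'r, 'a) fm set \<Rightarrow> 'k rel \<Rightarrow> ('s, 'f, 'r, 'a) model \<Rightarrow> bool" where
  "monster L T \<kappa> M \<longleftrightarrow>
     is_model L M \<and> (\<forall>\<phi> \<in> T. sat_tup M [] \<phi>) \<and>
     Card_order \<kappa> \<and> small \<kappa> (\<Union>\<Gamma>. fmls L M {} \<Gamma>) \<and>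
     (\<forall>s A. A \<subseteq> univ M \<longrightarrow> small \<kappa> A \<longrightarrow> (\<forall>p \<in> types L M s A. realizations M s p \<noteq> {}))"

definition expands_group :: "('s, 'f, 'r) lang \<Rightarrow> ('s, 'f, 'r, 'a) model \<Rightarrow> bool" where
  "expands_group L M \<longleftrightarrow>
     fun_sig L (gmul L) = Some ([gsort L, gsort L], gsort L) \<and>
     (\<exists>e. group \<lparr>carrier = Dom M (gsort L), monoid.mult = (\<lambda>a b. fun_int M (gmul L) [a, b]),
                 one = e\<rparr>)"

abbreviation fmls_x ::
  "('s, 'f, 'r) lang \<Rightarrow> ('s, 'f, 'r, 'a) model \<Rightarrow> 'a set \<Rightarrow> ('s, 'f, 'r, 'a) fm set" where
  "fmls_x L M A \<equiv> fmls L M A [gsort L]"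

abbreviation types_x ::
  "('s, 'f, 'r) lang \<Rightarrow> ('s, 'f, 'r, 'a) model \<Rightarrow> 'a set \<Rightarrow> ('s, 'f, 'r, 'a) fm set set" where
  "types_x L M A \<equiv> types L M (gsort L) A"

definition type_topology ::
  "('s, 'f, 'r) lang \<Rightarrow> ('s, 'f, 'r, 'a) model \<Rightarrow> 'a set \<Rightarrow> ('s, 'f, 'r, 'a) fm set topology" where
  "type_topology L M A =
     topology_generated_by {{p \<in> types_x L M A. \<phi> \<in> p} |\<phi>. \<phi> \<in> fmls_x L M A}"

definition inv_types ::
  "('s, 'f, 'r) lang \<Rightarrow> ('s, 'f, 'r, 'a) model \<Rightarrow> ('s, 'f, 'r, 'a) model
     \<Rightarrow> ('s, 'f, 'r, 'a) fm set set" where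
  "inv_types L M G =
     {p \<in> types_x L M (univ M).
        \<forall>bs \<in> lists (univ M). \<forall>bs' \<in> lists (univ M). tup_equiv L M (univ G) bs bs' \<longrightarrow>
          (\<forall>\<phi> \<in> fmls L M (univ G) (gsort L # map (sort_of M) bs).
             inst_pars bs \<phi> \<in> p \<longleftrightarrow> inst_pars bs' \<phi> \<in> p)}"

definition tp ::
  "('s, 'f, 'r) lang \<Rightarrow> ('s, 'f, 'r, 'a) model \<Rightarrow> 'a \<Rightarrow> 'a set \<Rightarrow> ('s, 'f, 'r, 'a) fm set" where
  "tp L M a A = {\<phi> \<in> fmls_x L M A. sat_tup M [a] \<phi>}"

text \<open>The unique \<open>G\<close>-invariant extension of \<open>p\<close> to the larger monster model \<open>M'\<close>.\<close>

definition inv_ext ::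
  "('s, 'f, 'r) lang \<Rightarrow> ('s, 'f, 'r, 'a) model \<Rightarrow> ('s, 'f, 'r, 'a) model
     \<Rightarrow> ('s, 'f, 'r, 'a) fm set \<Rightarrow> ('s, 'f, 'r, 'a) fm set" where
  "inv_ext L M' G p = (THE p'. p' \<in> inv_types L M' G \<and> p \<subseteq> p')"

text \<open>\<open>p * q\<close>, computed in the larger monster model \<open>M'\<close> of \<open>M\<close>.\<close>

definition type_prod ::
  "('s, 'f, 'r) lang \<Rightarrow> ('s, 'f, 'r, 'a) model \<Rightarrow> ('s, 'f, 'r, 'a) model \<Rightarrow> ('s, 'f, 'r, 'a) model
     \<Rightarrow> ('s, 'f, 'r, 'a) fm set \<Rightarrow> ('s, 'f, 'r, 'a) fm set \<Rightarrow> ('s, 'f, 'r, 'a) fm set" where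
  "type_prod L M M' G p q =
     (THE r. \<exists>b \<in> realizations M' (gsort L) q.
        \<exists>a \<in> realizations M' (gsort L) (inv_ext L M' G p \<inter> fmls_x L M' (insert b (univ M))).
          r = tp L M' (fun_int M' (gmul L) [a, b]) (univ M))"


section \<open>Keisler measures\<close>

text \<open>
  Keisler measures are functions on formulas that are constant on classes of equivalent formulas
  (equivalently, functions on the quotient Boolean algebra).
\<close>

definition keisler ::
  "('s, 'f, 'r) lang \<Rightarrow> ('s, 'f, 'r, 'a) model \<Rightarrow> 'a set
     \<Rightarrow> (('s, 'f, 'r, 'a) fm \<Rightarrow> real) set" where
  "keisler L M A =
     {\<mu> \<in> fmls_x L M A \<rightarrow>\<^sub>E {0..1}.
        (\<forall>\<phi> \<in> fmls_x L M A. \<forall>\<psi> \<in> fmls_x L M A.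
           (\<forall>a \<in> Dom M (gsort L). sat_tup M [a] \<phi> \<longleftrightarrow> sat_tup M [a] \<psi>) \<longrightarrow> \<mu> \<phi> = \<mu> \<psi>) \<and>
        (\<forall>\<phi> \<in> fmls_x L M A. (\<forall>a \<in> Dom M (gsort L). sat_tup M [a] \<phi>) \<longrightarrow> \<mu> \<phi> = 1) \<and>
        (\<forall>\<phi> \<in> fmls_x L M A. \<forall>\<psi> \<in> fmls_x L M A.
           (\<forall>a \<in> Dom M (gsort L). \<not> (sat_tup M [a] \<phi> \<and> sat_tup M [a] \<psi>))
             \<longrightarrow> \<mu> (Or \<phi> \<psi>) = \<mu> \<phi> + \<mu> \<psi>)}"

definition keisler_topology ::
  "('s, 'f, 'r) lang \<Rightarrow> ('s, 'f, 'r, 'a) model \<Rightarrow> 'a set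
     \<Rightarrow> (('s, 'f, 'r, 'a) fm \<Rightarrow> real) topology" where
  "keisler_topology L M A =
     subtopology (product_topology (\<lambda>_. top_of_set {0..1}) (fmls_x L M A)) (keisler L M A)"

definition inv_keisler ::
  "('s, 'f, 'r) lang \<Rightarrow> ('s, 'f, 'r, 'a) model \<Rightarrow> ('s, 'f, 'r, 'a) model
     \<Rightarrow> (('s, 'f, 'r, 'a) fm \<Rightarrow> real) set" where
  "inv_keisler L M G =
     {\<mu> \<in> keisler L M (univ M).
        \<forall>bs \<in> lists (univ M). \<forall>bs' \<in> lists (univ M). tup_equiv L M (univ G) bs bs' \<longrightarrow>
          (\<forall>\<phi> \<in> fmls L M (univ G) (gsort L # map (sort_of M) bs).
             \<mu> (inst_pars bs \<phi>) = \<mu> (inst_pars bs' \<phi>))}"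

definition dirac ::
  "('s, 'f, 'r) lang \<Rightarrow> ('s, 'f, 'r, 'a) model \<Rightarrow> ('s, 'f, 'r, 'a) fm set
     \<Rightarrow> ('s, 'f, 'r, 'a) fm \<Rightarrow> real" where
  "dirac L M p = restrict (indicator p) (fmls_x L M (univ M))"

definition support ::
  "('s, 'f, 'r) lang \<Rightarrow> ('s, 'f, 'r, 'a) model \<Rightarrow> 'a set \<Rightarrow> (('s, 'f, 'r, 'a) fm \<Rightarrow> real)
     \<Rightarrow> ('s, 'f, 'r, 'a) fm set set" where
  "support L M A \<mu> = {p \<in> types_x L M A. \<forall>\<phi> \<in> p. \<mu> \<phi> > 0}"

definition borel_of :: "'b topology \<Rightarrow> 'b measure" where
  "borel_of X = sigma (topspace X) {U. openin X U}"

definition regular_borel_prob :: "'b topology \<Rightarrow> 'b measure \<Rightarrow> bool" where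
  "regular_borel_prob X m \<longleftrightarrow>
     prob_space m \<and> space m = topspace X \<and> sets m = sets (borel_of X) \<and>
     (\<forall>B \<in> sets m. emeasure m B = (INF U \<in> {U. openin X U \<and> B \<subseteq> U}. emeasure m U)) \<and>
     (\<forall>B \<in> sets m. emeasure m B = (SUP K \<in> {K. compactin X K \<and> K \<subseteq> B}. emeasure m K))"

text \<open>The regular Borel probability measure on the type space corresponding to \<open>\<mu>\<close>.\<close>

definition borel_ext ::
  "('s, 'f, 'r) lang \<Rightarrow> ('s, 'f, 'r, 'a) model \<Rightarrow> 'a set \<Rightarrow> (('s, 'f, 'r, 'a) fm \<Rightarrow> real)
     \<Rightarrow> ('s, 'f, 'r, 'a) fm set measure" where
  "borel_ext L M A \<mu> =
     (THE m. regular_borel_prob (type_topology L M A) m \<and>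
        (\<forall>\<phi> \<in> fmls_x L M A. measure m {p \<in> types_x L M A. \<phi> \<in> p} = \<mu> \<phi>))"


section \<open>Convolution\<close>

text \<open>
  \<open>conv_fun L M \<mu> \<phi>\<close> is the function \<open>F\<close>; its value at \<open>r\<close> is meaningful when \<open>\<mu>(\<phi>(x \<cdot> d))\<close>
  is the same for all realizations \<open>d\<close> of \<open>r\<close>. With de Bruijn indices the variables \<open>x\<close> and
  \<open>y\<close> are both the index \<open>0\<close>, so that \<open>\<nu>\<^sub>y\<close> is \<open>\<nu>\<close> itself.
\<close>

definition conv_fun ::
  "('s, 'f, 'r) lang \<Rightarrow> ('s, 'f, 'r, 'a) model \<Rightarrow> (('s, 'f, 'r, 'a) fm \<Rightarrow> real)
     \<Rightarrow> ('s, 'f, 'r, 'a) fm \<Rightarrow> ('s, 'f, 'r, 'a) fm set \<Rightarrow> real" where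
  "conv_fun L M \<mu> \<phi> r = (THE v. \<exists>d \<in> realizations M (gsort L) r. v = \<mu> (translate L d \<phi>))"

text \<open>The conditions on \<open>N\<close> in the definition of \<open>*\<close>-Borel pairs, for a given formula \<open>\<phi>\<close>.\<close>

definition conv_model ::
  "('s, 'f, 'r) lang \<Rightarrow> 'k rel \<Rightarrow> ('s, 'f, 'r, 'a) model
     \<Rightarrow> (('s, 'f, 'r, 'a) fm \<Rightarrow> real) \<Rightarrow> (('s, 'f, 'r, 'a) fm \<Rightarrow> real)
     \<Rightarrow> ('s, 'f, 'r, 'a) fm \<Rightarrow> ('s, 'f, 'r, 'a) model \<Rightarrow> bool" where
  "conv_model L \<kappa> M \<mu> \<nu> \<phi> N \<longleftrightarrow>
     elem_sub L N M \<and> small \<kappa> (univ N) \<and> \<phi> \<in> fmls_x L M (univ N) \<and>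
     (let S = support L M (univ N) (restrict \<nu> (fmls_x L M (univ N))) in
        (\<forall>r \<in> S. \<forall>d \<in> realizations M (gsort L) r. \<forall>d' \<in> realizations M (gsort L) r.
           \<mu> (translate L d \<phi>) = \<mu> (translate L d' \<phi>)) \<and>
        conv_fun L M \<mu> \<phi>
          \<in> borel_measurable (borel_of (subtopology (type_topology L M (univ N)) S)))"

definition star_borel ::
  "('s, 'f, 'r) lang \<Rightarrow> 'k rel \<Rightarrow> ('s, 'f, 'r, 'a) model
     \<Rightarrow> (('s, 'f, 'r, 'a) fm \<Rightarrow> real) \<Rightarrow> (('s, 'f, 'r, 'a) fm \<Rightarrow> real) \<Rightarrow> bool" where
  "star_borel L \<kappa> M \<mu> \<nu> \<longleftrightarrow> (\<forall>\<phi> \<in> fmls_x L M (univ M). \<exists>N. conv_model L \<kappa> M \<mu> \<nu> \<phi> N)"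

text \<open>\<open>\<mu> * \<nu>\<close>, for a \<open>*\<close>-Borel pair; the value at \<open>\<phi>\<close> does not depend on the chosen \<open>N\<close>.\<close>

definition conv ::
  "('s, 'f, 'r) lang \<Rightarrow> 'k rel \<Rightarrow> ('s, 'f, 'r, 'a) model
     \<Rightarrow> (('s, 'f, 'r, 'a) fm \<Rightarrow> real) \<Rightarrow> (('s, 'f, 'r, 'a) fm \<Rightarrow> real)
     \<Rightarrow> ('s, 'f, 'r, 'a) fm \<Rightarrow> real" where
  "conv L \<kappa> M \<mu> \<nu> = (\<lambda>\<phi> \<in> fmls_x L M (univ M).
     let N = (SOME N. conv_model L \<kappa> M \<mu> \<nu> \<phi> N);
         \<nu>\<^sub>N = restrict \<nu> (fmls_x L M (univ N))
     in integral\<^sup>L (restrict_space (borel_ext L M (univ N) \<nu>\<^sub>N) (support L M (univ N) \<nu>\<^sub>N))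
          (conv_fun L M \<mu> \<phi>))"

end

theory Submission
  imports Defs
begin

text \<open>
  The map \<open>p \<mapsto> \<delta>\<^sub>p\<close> is an embedding because the topologies on both sides are read off formula by formula:
  \<open>\<delta>\<^sub>p(\<phi>)\<close> is \<open>1\<close> or \<open>0\<close> according to whether \<open>p\<close> lies in the clopen set \<open>[\<phi>]\<close>, and conversely \<open>p\<close> is
  recovered from \<open>\<delta>\<^sub>p\<close> as the set of formulas of measure above \<open>1/2\<close>, an open condition on each
  coordinate (\<open>dirac_embedding\<close>).

  For the product formula, fix \<open>\<phi>\<close> over \<open>M\<close> and a small \<open>N \<prec> M\<close> containing its parameters. The support
  of \<open>\<delta>\<^sub>q|\<^sub>N\<close> is the single type \<open>q|\<^sub>N\<close>, and the Borel measure of \<open>\<delta>\<^sub>q|\<^sub>N\<close> is the point mass there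
  (\<open>support_dirac\<close>, \<open>borel_ext_dirac\<close>). Measurability on a one-point space is automatic, and the
  convolution integral is the value of the integrand at \<open>q|\<^sub>N\<close>, which is \<open>1\<close> if \<open>\<phi>(x \<cdot> d) \<in> p\<close> for
  \<open>d \<Turnstile> q|\<^sub>N\<close> and \<open>0\<close> otherwise. If \<open>N\<close> contains \<open>G\<close>, then \<open>G\<close>-invariance of \<open>p\<close> makes this
  independent of \<open>d\<close> (\<open>translate_cong\<close>); such an \<open>N\<close> exists by the downward Loewenheim-Skolem theorem
  (\<open>small_elem_sub_containing\<close>), so the pair is \<open>*\<close>-Borel. The convolution, however, is evaluated at
  an arbitrary admissible \<open>N\<close>, which need not contain \<open>G\<close>; there the value is computed at a \<open>d\<close> realizing
  the stronger type \<open>q|\<^sub>N\<^sub>\<union>\<^sub>G\<close>, which saturation provides (\<open>conv_fun_dirac\<close>).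

  On the other side, let \<open>p'\<close> be the \<open>G\<close>-invariant extension of \<open>p\<close> to \<open>M'\<close> and \<open>b \<Turnstile> q\<close> in \<open>M'\<close>. Then
  \<open>\<phi> \<in> p * q\<close> iff \<open>\<phi>(x \<cdot> b) \<in> p'\<close>. Since \<open>b\<close> and \<open>d\<close> have the same type over \<open>G\<close> and the parameters of
  \<open>\<phi>\<close>, invariance of \<open>p'\<close> replaces \<open>b\<close> by \<open>d \<in> M\<close>, where \<open>p'\<close> agrees with \<open>p\<close>
  (\<open>prod_type_realization\<close>). So both sides have the same value at \<open>\<phi>\<close>.

  As \<open>p * q\<close> is defined by definite descriptions, existence and uniqueness of \<open>p'\<close> and of
  \<open>tp(a \<cdot> b/M)\<close> have to be established as well. The extension is \<open>transfer_type\<close>: a formula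
  \<open>\<psi>(x; b')\<close> over \<open>M'\<close> belongs to it iff \<open>\<psi>(x; b) \<in> p\<close> for a tuple \<open>b\<close> of \<open>M\<close> with \<open>b \<equiv>\<^sub>G b'\<close>. Saturation
  of \<open>M\<close> over the small set \<open>G\<close> supplies such tuples (\<open>monster_realizes_tuple\<close>), and \<open>transfer_imp\<close>
  shows that the choice is immaterial.
\<close>

section \<open>Substitution and well-sortedness\<close>

lemma tm_val_subst: "tm_val M v (subst_tm \<sigma> t) = tm_val M (\<lambda>i. tm_val M v (\<sigma> i)) t"
  by (induction t) (auto simp: comp_def cong: map_cong)

lemma sat_subst: "sat M v (subst_fm \<sigma> \<phi>) = sat M (\<lambda>i. tm_val M v (\<sigma> i)) \<phi>"
proof (induction \<phi> arbitrary: v \<sigma>)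
  case (Exi s \<phi>)
  have "(\<lambda>i. tm_val M (case_nat a v)
            (case i of 0 \<Rightarrow> Var 0 | Suc i \<Rightarrow> subst_tm (\<lambda>j. Var (Suc j)) (\<sigma> i)))
        = case_nat a (\<lambda>i. tm_val M v (\<sigma> i))" for a
    by (auto simp: fun_eq_iff tm_val_subst split: nat.split)
  then show ?case by (simp add: Exi.IH)
qed (simp_all add: tm_val_subst comp_def)

lemma tm_val_cong:
  assumes "has_sort L M A \<Gamma> t s" "\<And>i. i < length \<Gamma> \<Longrightarrow> v i = w i"
  shows "tm_val K v t = tm_val K w t"
  using assms(1)
proof (induction rule: has_sort.induct)
  case (has_sort_App f ss s ts)
  then have "map (tm_val K v) ts = map (tm_val K w) ts"
    by (auto simp: list_all2_conv_all_nth in_set_conv_nth)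
  then show ?case by (simp only: tm_val.simps)
qed (use assms(2) in auto)

lemma sat_cong:
  assumes "wf_fm L M A \<Gamma> \<phi>" "\<And>i. i < length \<Gamma> \<Longrightarrow> v i = w i"
  shows "sat K v \<phi> = sat K w \<phi>"
  using assms
proof (induction \<phi> arbitrary: \<Gamma> v w)
  case (Eql t u)
  then obtain s where "has_sort L M A \<Gamma> t s" "has_sort L M A \<Gamma> u s" by auto
  then have "tm_val K v t = tm_val K w t" "tm_val K v u = tm_val K w u"
    using Eql.prems(2) by (auto intro!: tm_val_cong[of L M A \<Gamma> _ s v w])
  then show ?case by simp
next
  case (Atom r ts)
  from Atom obtain ss where "list_all2 (has_sort L M A \<Gamma>) ts ss" by auto
  then have *: "\<forall>t\<in>set ts. \<exists>s. has_sort L M A \<Gamma> t s"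
    by (metis in_set_conv_nth list_all2_nthD)
  have "tm_val K v t = tm_val K w t" if "t \<in> set ts" for t
  proof -
    from * that obtain s where "has_sort L M A \<Gamma> t s" by blast
    then show ?thesis by (rule tm_val_cong) (rule Atom.prems(2))
  qed
  then have "map (tm_val K v) ts = map (tm_val K w) ts" by simp
  then show ?case by (simp only: sat.simps)
next
  case (Exi s \<phi>)
  have "sat K (case_nat a v) \<phi> = sat K (case_nat a w) \<phi>" for a
    using Exi.prems by (intro Exi.IH) (auto split: nat.split)
  then show ?case by simp
next
  case (And \<phi> \<psi>)
  show ?case using And.IH(1)[of \<Gamma> v w] And.IH(2)[of \<Gamma> v w] And.prems by simp
next
  case (Neg \<phi>)
  show ?case using Neg.IH[of \<Gamma> v w] Neg.prems by simp
qed simp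

lemma has_sort_subst:
  assumes "has_sort L M A \<Gamma> t s"
    and "\<And>i. i < length \<Gamma> \<Longrightarrow> has_sort L M' B \<Delta> (\<sigma> i) (\<Gamma> ! i)"
    and "A \<subseteq> B" "A \<subseteq> univ M'" "\<And>a. a \<in> A \<Longrightarrow> a \<in> univ M \<Longrightarrow> sort_of M a = sort_of M' a"
  shows "has_sort L M' B \<Delta> (subst_tm \<sigma> t) s"
  using assms(1)
proof (induction rule: has_sort.induct)
  case (has_sort_Par a)
  then show ?case using assms(3-) has_sort.has_sort_Par[of a B M' L \<Delta>] by auto
next
  case (has_sort_App f ss s ts)
  then show ?case
    by (auto intro!: has_sort.has_sort_App simp: list_all2_conv_all_nth)
qed (use assms(2) in auto)

text \<open>
  Allowing the structure and the parameter set to change together with the substitution gives, for the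
  identity substitution, the change to another structure and to a longer list of variables
  (\<open>wf_fm_mono\<close>).
\<close>

lemma wf_subst:
  assumes "wf_fm L M A \<Gamma> \<phi>"
    and "\<And>i. i < length \<Gamma> \<Longrightarrow> has_sort L M' B \<Delta> (\<sigma> i) (\<Gamma> ! i)"
    and "A \<subseteq> B" "A \<subseteq> univ M'" "B \<subseteq> univ M'"
      "\<And>a. a \<in> A \<Longrightarrow> a \<in> univ M \<Longrightarrow> sort_of M a = sort_of M' a"
  shows "wf_fm L M' B \<Delta> (subst_fm \<sigma> \<phi>)"
  using assms(1,2)
proof (induction \<phi> arbitrary: \<Gamma> \<Delta> \<sigma>)
  case (Eql t u)
  have "has_sort L M' B \<Delta> (subst_tm \<sigma> t) s" if "has_sort L M A \<Gamma> t s" for t s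
    by (rule has_sort_subst[OF that Eql.prems(2) assms(3,4,6)])
  then show ?case using Eql.prems(1) by auto
next
  case (Atom r ts)
  have "has_sort L M' B \<Delta> (subst_tm \<sigma> t) s" if "has_sort L M A \<Gamma> t s" for t s
    by (rule has_sort_subst[OF that Atom.prems(2) assms(3,4,6)])
  then show ?case using Atom.prems(1)
    by (auto simp: list_all2_conv_all_nth)
next
  case (Exi s \<phi>)
  have "wf_fm L M' B (s # \<Delta>)
     (subst_fm (case_nat (Var 0) (\<lambda>i. subst_tm (\<lambda>j. Var (Suc j)) (\<sigma> i))) \<phi>)"
  proof (rule Exi.IH)
    show "wf_fm L M A (s # \<Gamma>) \<phi>" using Exi.prems by simp
    fix i assume i: "i < length (s # \<Gamma>)"
    have sh: "has_sort L M' B (s # \<Delta>) (Var (Suc j)) (\<Delta> ! j)" if "j < length \<Delta>" for j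
      using has_sort_Var[of "Suc j" "s # \<Delta>" L M' B] that by simp
    show "has_sort L M' B (s # \<Delta>)
      (case i of 0 \<Rightarrow> Var 0 | Suc i \<Rightarrow> subst_tm (\<lambda>j. Var (Suc j)) (\<sigma> i)) ((s # \<Gamma>) ! i)"
    proof (cases i)
      case 0
      then show ?thesis using has_sort_Var[of 0 "s # \<Delta>" L M' B] by simp
    next
      case (Suc j)
      then show ?thesis using i assms(5)
        by (auto intro!: has_sort_subst[OF Exi.prems(2) sh])
    qed
  qed
  then show ?case by simp
qed auto

lemma subst_Var: "subst_tm Var t = t"
  by (induction t) (auto simp: map_idI)

lemma subst_fm_Var:
  fixes \<phi> :: "('s, 'f, 'r, 'a) fm"
  shows "subst_fm Var \<phi> = \<phi>"
proof (induction \<phi>)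
  case (Exi s \<phi>)
  have "case_nat (Var 0) (\<lambda>i. Var (Suc i)) = (Var :: nat \<Rightarrow> ('f, 'a) tm)" by (auto simp: fun_eq_iff split: nat.split)
  then show ?case using Exi by simp
qed (simp_all add: subst_Var map_idI)

lemma wf_fm_mono:
  assumes "wf_fm L M A \<Gamma> \<phi>" "A \<subseteq> B" "B \<subseteq> univ M'"
    and "\<And>a. a \<in> A \<Longrightarrow> a \<in> univ M \<Longrightarrow> sort_of M a = sort_of M' a"
  shows "wf_fm L M' B (\<Gamma> @ \<Delta>) \<phi>"
proof -
  have "wf_fm L M' B (\<Gamma> @ \<Delta>) (subst_fm Var \<phi>)"
  proof (rule wf_subst[OF assms(1)])
    fix i assume "i < length \<Gamma>"
    then show "has_sort L M' B (\<Gamma> @ \<Delta>) (Var i) (\<Gamma> ! i)"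
      using has_sort_Var[of i "\<Gamma> @ \<Delta>" L M' B] by (simp add: nth_append)
  qed (use assms in auto)
  then show ?thesis by (simp add: subst_fm_Var)
qed

section \<open>Trading parameters for variables\<close>

text \<open>
  The substitution that keeps the first \<open>k\<close> variables and plugs \<open>bs\<close> into the following ones. Passing
  under a quantifier turns \<open>plug k bs\<close> into \<open>plug (Suc k) bs\<close>, so that inductions on formulas need all \<open>k\<close>;
  \<open>inst_pars\<close> is the case \<open>k = 1\<close>.
\<close>

definition plug :: "nat \<Rightarrow> 'a list \<Rightarrow> nat \<Rightarrow> ('f, 'a) tm" where
  "plug k bs i = (if i < k then Var i else Par (bs ! (i - k)))"

lemma plug_lift: "case_nat (Var 0) (\<lambda>i. subst_tm (\<lambda>j. Var (Suc j)) (plug k bs i)) = plug (Suc k) bs"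
  by (auto simp: fun_eq_iff plug_def split: nat.split)

lemma inst_pars_plug:
  fixes \<phi> :: "('s, 'f, 'r, 'a) fm"
  shows "inst_pars bs \<phi> = subst_fm (plug 1 bs) \<phi>"
proof -
  have "case_nat (Var 0) (\<lambda>i. Par (bs ! i)) = (plug 1 bs :: nat \<Rightarrow> ('f, 'a) tm)"
    by (auto simp: fun_eq_iff plug_def split: nat.split)
  then show ?thesis by (simp add: inst_pars_def)
qed

definition position :: "'a list \<Rightarrow> 'a \<Rightarrow> nat" where
  "position bs a = (SOME i. i < length bs \<and> bs ! i = a)"

lemma position: assumes "a \<in> set bs" shows "position bs a < length bs" "bs ! position bs a = a"
proof -
  have "\<exists>i. i < length bs \<and> bs ! i = a" using assms by (auto simp: in_set_conv_nth)
  from someI_ex[OF this] show "position bs a < length bs" "bs ! position bs a = a"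
    by (auto simp: position_def)
qed

text \<open>
  The inverse operation: the parameters in \<open>bs\<close> become the variables \<open>k, k + 1, \<dots>\<close>. Free variables are
  left alone, so this is meaningful only when all of them are below \<open>k\<close>.
\<close>

primrec abst_tm :: "nat \<Rightarrow> 'a list \<Rightarrow> ('f, 'a) tm \<Rightarrow> ('f, 'a) tm" where
  "abst_tm k bs (Var i) = Var i"
| "abst_tm k bs (Par a) = (if a \<in> set bs then Var (k + position bs a) else Par a)"
| "abst_tm k bs (App f ts) = App f (map (abst_tm k bs) ts)"

primrec abst_fm :: "nat \<Rightarrow> 'a list \<Rightarrow> ('s, 'f, 'r, 'a) fm \<Rightarrow> ('s, 'f, 'r, 'a) fm" where
  "abst_fm k bs Fls = Fls"
| "abst_fm k bs (Eql t u) = Eql (abst_tm k bs t) (abst_tm k bs u)"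
| "abst_fm k bs (Atom r ts) = Atom r (map (abst_tm k bs) ts)"
| "abst_fm k bs (Neg \<phi>) = Neg (abst_fm k bs \<phi>)"
| "abst_fm k bs (And \<phi> \<psi>) = And (abst_fm k bs \<phi>) (abst_fm k bs \<psi>)"
| "abst_fm k bs (Exi s \<phi>) = Exi s (abst_fm (Suc k) bs \<phi>)"

lemma abst_tm:
  assumes "has_sort L M (A \<union> set bs) \<Gamma> t s"
  shows "has_sort L M A (\<Gamma> @ map (sort_of M) bs) (abst_tm (length \<Gamma>) bs t) s
     \<and> subst_tm (plug (length \<Gamma>) bs) (abst_tm (length \<Gamma>) bs t) = t"
  using assms
proof (induction rule: has_sort.induct)
  case (has_sort_Var i)
  then show ?case
    using has_sort.has_sort_Var[of i "\<Gamma> @ map (sort_of M) bs" L M A] by (simp add: nth_append plug_def)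
next
  case (has_sort_Par a)
  then show ?case
    using has_sort.has_sort_Par[of a A M L]
      has_sort.has_sort_Var[of "length \<Gamma> + position bs a" "\<Gamma> @ map (sort_of M) bs" L M A]
    by (auto simp: plug_def position)
next
  case (has_sort_App f ss s ts)
  then show ?case
    by (auto intro!: has_sort.has_sort_App map_idI simp: list_all2_conv_all_nth in_set_conv_nth)
qed

lemma abst_fm:
  assumes "wf_fm L M (A \<union> set bs) \<Gamma> \<phi>"
  shows "wf_fm L M A (\<Gamma> @ map (sort_of M) bs) (abst_fm (length \<Gamma>) bs \<phi>)
     \<and> subst_fm (plug (length \<Gamma>) bs) (abst_fm (length \<Gamma>) bs \<phi>) = \<phi>"
  using assms
proof (induction \<phi> arbitrary: \<Gamma>)
  case (Eql t u)
  then show ?case using abst_tm[of L M A bs \<Gamma>] by auto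
next
  case (Atom r ts)
  then obtain ss where ss: "list_all2 (has_sort L M (A \<union> set bs) \<Gamma>) ts ss"
    and "rel_sig L r = Some ss" by auto
  moreover have *: "has_sort L M A (\<Gamma> @ map (sort_of M) bs) (abst_tm (length \<Gamma>) bs (ts ! i)) (ss ! i)
     \<and> subst_tm (plug (length \<Gamma>) bs) (abst_tm (length \<Gamma>) bs (ts ! i)) = ts ! i"
    if "i < length ts" for i
    by (rule abst_tm) (rule list_all2_nthD[OF ss that])
  have "list_all2 (has_sort L M A (\<Gamma> @ map (sort_of M) bs)) (map (abst_tm (length \<Gamma>) bs) ts) ss"
    using * list_all2_lengthD[OF ss] by (simp add: list_all2_conv_all_nth)
  moreover have "map (subst_tm (plug (length \<Gamma>) bs) \<circ> abst_tm (length \<Gamma>) bs) ts = ts"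
    using * by (simp add: list_eq_iff_nth_eq)
  ultimately show ?case by simp
next
  case (Exi s \<phi>)
  from Exi.IH[of "s # \<Gamma>"] Exi.prems show ?case by (simp add: plug_lift)
qed simp_all

text \<open>
  Invariance of types and measures, and elementarity of substructures, are expressed by tuples
  substituted into formulas with few parameters. This lemma brings an arbitrary formula with parameters
  into that form.
\<close>

lemma fmls_abstract:
  assumes "\<phi> \<in> fmls L M (A \<union> set bs) \<Gamma>"
  obtains \<psi> where "\<psi> \<in> fmls L M A (\<Gamma> @ map (sort_of M) bs)" "subst_fm (plug (length \<Gamma>) bs) \<psi> = \<phi>"
  using abst_fm[of L M A bs \<Gamma> \<phi>] assms by (auto simp: fmls_def)

lemma fmls_inst:
  assumes "\<psi> \<in> fmls L M A (\<Gamma> @ map (sort_of M) bs)" "A \<union> set bs \<subseteq> B" "B \<subseteq> univ M"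
  shows "subst_fm (plug (length \<Gamma>) bs) \<psi> \<in> fmls L M B \<Gamma>"
  unfolding fmls_def mem_Collect_eq
proof (rule wf_subst)
  show "wf_fm L M A (\<Gamma> @ map (sort_of M) bs) \<psi>" using assms by (simp add: fmls_def)
  fix i assume i: "i < length (\<Gamma> @ map (sort_of M) bs)"
  show "has_sort L M B \<Gamma> (plug (length \<Gamma>) bs i) ((\<Gamma> @ map (sort_of M) bs) ! i)"
  proof (cases "i < length \<Gamma>")
    case True
    then show ?thesis using has_sort_Var[OF True, of L M B] by (simp add: nth_append plug_def)
  next
    case False
    then have "bs ! (i - length \<Gamma>) \<in> set bs" using i by auto
    then have "bs ! (i - length \<Gamma>) \<in> B" "bs ! (i - length \<Gamma>) \<in> univ M" using assms by auto
    then show ?thesis using i False has_sort_Par[of "bs ! (i - length \<Gamma>)" B M L \<Gamma>]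
      by (simp add: nth_append plug_def)
  qed
qed (use assms in auto)

lemma sat_plug:
  "sat M v (subst_fm (plug k bs) \<psi>) = sat M (\<lambda>i. if i < k then v i else bs ! (i - k)) \<psi>"
proof -
  have "(\<lambda>i. tm_val M v (plug k bs i)) = (\<lambda>i. if i < k then v i else bs ! (i - k))"
    by (auto simp: plug_def)
  then show ?thesis by (simp add: sat_subst)
qed

lemma sat_tup_plug:
  "sat_tup M as (subst_fm (plug (length as) bs) \<psi>) = sat_tup M (as @ bs) \<psi>"
proof -
  have "(\<lambda>i. if i < length as then as ! i else bs ! (i - length as)) = (!) (as @ bs)"
    by (auto simp: nth_append)
  then show ?thesis by (simp add: sat_tup_def sat_plug)
qed

lemma sat_tup_inst_pars: "sat_tup M [a] (inst_pars bs \<psi>) = sat_tup M (a # bs) \<psi>"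
  using sat_tup_plug[of M "[a]" bs \<psi>] by (simp add: inst_pars_plug)

lemma inst_pars_fmls:
  assumes "\<psi> \<in> fmls L M A (s # map (sort_of M) bs)" "A \<union> set bs \<subseteq> B" "B \<subseteq> univ M"
  shows "inst_pars bs \<psi> \<in> fmls L M B [s]"
  using fmls_inst[of \<psi> L M A "[s]" bs B] assms by (simp add: inst_pars_plug)

lemma fmls_abstract1:
  assumes "\<phi> \<in> fmls L M (A \<union> set bs) [s]"
  obtains \<psi> where "\<psi> \<in> fmls L M A (s # map (sort_of M) bs)" "inst_pars bs \<psi> = \<phi>"
  using fmls_abstract[OF assms] by (auto simp: inst_pars_plug)

text \<open>The parameters of a formula are collected by the set function of the datatype for its last type
  argument.\<close>

lemma finite_params: "finite (set4_fm \<phi>)"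
proof -
  have tm: "finite (set2_tm t)" for t :: "('f,'a) tm"
    by (induction t) auto
  show ?thesis by (induction \<phi>) (auto simp: tm)
qed

lemma has_sort_params:
  assumes "has_sort L M A \<Gamma> t s"
  shows "set2_tm t \<subseteq> A \<inter> univ M \<and> (set2_tm t \<subseteq> B \<longrightarrow> has_sort L M B \<Gamma> t s)"
  using assms
proof (induction rule: has_sort.induct)
  case (has_sort_App f ss s ts)
  have "\<And>t. t \<in> set ts \<Longrightarrow> set2_tm t \<subseteq> A \<inter> univ M"
    using has_sort_App by (auto simp: list_all2_conv_all_nth in_set_conv_nth)
  moreover have "has_sort L M B \<Gamma> (App f ts) s" if "set2_tm (App f ts) \<subseteq> B"
  proof (rule has_sort.has_sort_App[OF has_sort_App(1)])
    have "set2_tm (ts ! i) \<subseteq> B" if "i < length ts" for i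
      using \<open>set2_tm (App f ts) \<subseteq> B\<close> nth_mem[OF that] by auto
    then show "list_all2 (has_sort L M B \<Gamma>) ts ss"
      using has_sort_App(2) by (auto simp: list_all2_conv_all_nth)
  qed
  ultimately show ?case by auto
qed (auto intro: has_sort.intros)

lemma wf_params:
  assumes "wf_fm L M A \<Gamma> \<phi>"
  shows "set4_fm \<phi> \<subseteq> A \<inter> univ M \<and> (set4_fm \<phi> \<subseteq> B \<longrightarrow> wf_fm L M B \<Gamma> \<phi>)"
  using assms
proof (induction \<phi> arbitrary: \<Gamma>)
  case (Eql t u)
  then show ?case using has_sort_params[of L M A \<Gamma> _ _ B] by simp blast
next
  case (Atom r ts)
  then obtain ss where ss: "rel_sig L r = Some ss" "list_all2 (has_sort L M A \<Gamma>) ts ss" by auto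
  have "\<And>t. t \<in> set ts \<Longrightarrow> set2_tm t \<subseteq> A \<inter> univ M"
    using ss(2) has_sort_params[of L M A \<Gamma> _ _ B] by (fastforce simp: list_all2_conv_all_nth in_set_conv_nth)
  moreover have "list_all2 (has_sort L M B \<Gamma>) ts ss" if "set4_fm (Atom r ts) \<subseteq> B"
  proof -
    have "set2_tm (ts ! i) \<subseteq> B" if "i < length ts" for i
      using \<open>set4_fm (Atom r ts) \<subseteq> B\<close> nth_mem[OF that] by auto
    then show ?thesis
      using ss(2) has_sort_params[of L M A \<Gamma> _ _ B] by (auto simp: list_all2_conv_all_nth)
  qed
  ultimately show ?case using ss(1) by auto
next
  case (And \<phi> \<psi>)
  from And.prems have "wf_fm L M A \<Gamma> \<phi>" "wf_fm L M A \<Gamma> \<psi>" by simp_all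
  from And.IH(1)[OF this(1)] And.IH(2)[OF this(2)] show ?case by auto
qed auto

lemma fmls_params: "\<phi> \<in> fmls L M A \<Gamma> \<Longrightarrow> \<phi> \<in> fmls L M (set4_fm \<phi>) \<Gamma>"
  using wf_params[of L M A \<Gamma> \<phi>] by (auto simp: fmls_def)

lemma params_subset: "\<phi> \<in> fmls L M A \<Gamma> \<Longrightarrow> set4_fm \<phi> \<subseteq> A \<inter> univ M"
  using wf_params[of L M A \<Gamma> \<phi>] by (auto simp: fmls_def)

lemma fmls_mono: "\<phi> \<in> fmls L M A \<Gamma> \<Longrightarrow> A \<subseteq> B \<Longrightarrow> \<phi> \<in> fmls L M B \<Gamma>"
  using wf_params[of L M A \<Gamma> \<phi> B] by (auto simp: fmls_def)

lemma fmls_append: "\<phi> \<in> fmls L M A \<Gamma> \<Longrightarrow> A \<subseteq> univ M \<Longrightarrow> \<phi> \<in> fmls L M A (\<Gamma> @ \<Delta>)"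
  using wf_fm_mono[of L M A \<Gamma> \<phi> A M \<Delta>] by (auto simp: fmls_def)

lemma fmls_simps [simp]:
  "Fls \<in> fmls L M A \<Gamma>"
  "Neg \<phi> \<in> fmls L M A \<Gamma> \<longleftrightarrow> \<phi> \<in> fmls L M A \<Gamma>"
  "And \<phi> \<psi> \<in> fmls L M A \<Gamma> \<longleftrightarrow> \<phi> \<in> fmls L M A \<Gamma> \<and> \<psi> \<in> fmls L M A \<Gamma>"
  "Or \<phi> \<psi> \<in> fmls L M A \<Gamma> \<longleftrightarrow> \<phi> \<in> fmls L M A \<Gamma> \<and> \<psi> \<in> fmls L M A \<Gamma>"
  "Exi s \<phi> \<in> fmls L M A \<Gamma> \<longleftrightarrow> \<phi> \<in> fmls L M A (s # \<Gamma>)"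
  by (auto simp: fmls_def Or_def)

lemma case_nat_nth: "case_nat a ((!) as) = (!) (a # as)"
proof
  show "case_nat a ((!) as) i = (a # as) ! i" for i by (cases i) simp_all
qed

lemma sat_tup_simps [simp]:
  "\<not> sat_tup M as Fls"
  "sat_tup M as (Neg \<phi>) \<longleftrightarrow> \<not> sat_tup M as \<phi>"
  "sat_tup M as (And \<phi> \<psi>) \<longleftrightarrow> sat_tup M as \<phi> \<and> sat_tup M as \<psi>"
  "sat_tup M as (Or \<phi> \<psi>) \<longleftrightarrow> sat_tup M as \<phi> \<or> sat_tup M as \<psi>"
  "sat_tup M as (Exi s \<phi>) \<longleftrightarrow> (\<exists>a \<in> Dom M s. sat_tup M (a # as) \<phi>)"
  by (simp_all add: sat_tup_def Or_def case_nat_nth)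

definition conj_list :: "('s, 'f, 'r, 'a) fm list \<Rightarrow> ('s, 'f, 'r, 'a) fm" where
  "conj_list fs = foldr And fs (Neg Fls)"

lemma conj_list_fmls: "conj_list fs \<in> fmls L M A \<Gamma> \<longleftrightarrow> set fs \<subseteq> fmls L M A \<Gamma>"
  by (induction fs) (auto simp: conj_list_def)

lemma sat_conj_list: "sat_tup M as (conj_list fs) \<longleftrightarrow> (\<forall>\<phi>\<in>set fs. sat_tup M as \<phi>)"
  by (induction fs) (auto simp: conj_list_def)

section \<open>Elementary substructures\<close>

lemma elem_subD:
  assumes "elem_sub L N M"
  shows "is_model L N" "is_model L M" "univ N \<subseteq> univ M"
    "a \<in> univ N \<Longrightarrow> sort_of N a = sort_of M a" "Dom N s \<subseteq> Dom M s"
    "Dom N s = Dom M s \<inter> univ N"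
    "as \<in> lists (univ N) \<Longrightarrow> \<phi> \<in> fmls L M {} (map (sort_of M) as) \<Longrightarrow> sat_tup N as \<phi> = sat_tup M as \<phi>"
proof -
  show "as \<in> lists (univ N) \<Longrightarrow> \<phi> \<in> fmls L M {} (map (sort_of M) as) \<Longrightarrow> sat_tup N as \<phi> = sat_tup M as \<phi>"
    using assms unfolding elem_sub_def by blast
  show "is_model L N" "is_model L M" "univ N \<subseteq> univ M"
    using assms unfolding elem_sub_def by blast+
  have "\<forall>a\<in>univ N. sort_of N a = sort_of M a" using assms unfolding elem_sub_def by blast
  then show "a \<in> univ N \<Longrightarrow> sort_of N a = sort_of M a" "Dom N s \<subseteq> Dom M s"
    "Dom N s = Dom M s \<inter> univ N"
    using \<open>univ N \<subseteq> univ M\<close> unfolding Dom_def by auto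
qed

lemma fmls_elem_sub:
  assumes "elem_sub L N M" "A \<subseteq> univ N"
  shows "fmls L N A \<Gamma> = fmls L M A \<Gamma>"
proof -
  note D = elem_subD(3)[OF assms(1)]
  have eq: "sort_of N a = sort_of M a" if "a \<in> A" for a
    using that assms(2) elem_subD(4)[OF assms(1)] by blast
  have "wf_fm L M A (\<Gamma> @ []) \<phi>" if "wf_fm L N A \<Gamma> \<phi>" for \<phi>
    by (rule wf_fm_mono[OF that order_refl]) (use assms(2) D in blast, rule eq)
  moreover have "wf_fm L N A (\<Gamma> @ []) \<phi>" if "wf_fm L M A \<Gamma> \<phi>" for \<phi>
    by (rule wf_fm_mono[OF that order_refl]) (use assms(2) in blast, rule eq[symmetric])
  ultimately show ?thesis unfolding fmls_def append_Nil2 by blast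
qed

text \<open>Parameters of the formula are moved into the tuple, where the definition of elementarity applies.\<close>

lemma sat_elem_sub:
  assumes "elem_sub L N M" "as \<in> lists (univ N)" "\<phi> \<in> fmls L M (univ N) (map (sort_of M) as)"
  shows "sat_tup N as \<phi> = sat_tup M as \<phi>"
proof -
  obtain bs where bs: "set bs = set4_fm \<phi>" using finite_list[OF finite_params[of \<phi>]] by auto
  have sub: "set bs \<subseteq> univ N" using params_subset[OF assms(3)] bs by auto
  have "\<phi> \<in> fmls L M ({} \<union> set bs) (map (sort_of M) as)" using fmls_params[OF assms(3)] bs by simp
  then obtain \<psi> where \<psi>: "\<psi> \<in> fmls L M {} (map (sort_of M) as @ map (sort_of M) bs)"
    and e: "subst_fm (plug (length (map (sort_of M) as)) bs) \<psi> = \<phi>" by (rule fmls_abstract)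
  have "sat_tup N (as @ bs) \<psi> = sat_tup M (as @ bs) \<psi>"
    using \<psi> sub assms(2) by (intro elem_subD(7)[OF assms(1)]) auto
  then show ?thesis
    using sat_tup_plug[of N as bs \<psi>] sat_tup_plug[of M as bs \<psi>] e by simp
qed

lemma Dom_ex_elem_sub:
  assumes "elem_sub L N M" "bs \<in> lists (univ N)" "\<phi> \<in> fmls L M (univ N) (s # map (sort_of M) bs)"
  shows "(\<exists>a\<in>Dom N s. sat_tup N (a # bs) \<phi>) = (\<exists>a\<in>Dom M s. sat_tup M (a # bs) \<phi>)"
  using sat_elem_sub[OF assms(1,2), of "Exi s \<phi>"] assms(3) by simp

section \<open>Tuples with the same type\<close>

lemma tup_equiv_refl: "tup_equiv L M A bs bs" by (simp add: tup_equiv_def)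
lemma tup_equiv_sym: "tup_equiv L M A bs cs \<Longrightarrow> tup_equiv L M A cs bs" by (simp add: tup_equiv_def)
lemma tup_equiv_trans: "tup_equiv L M A bs cs \<Longrightarrow> tup_equiv L M A cs ds \<Longrightarrow> tup_equiv L M A bs ds"
  by (simp add: tup_equiv_def)
lemma tup_equiv_length: "tup_equiv L M A bs cs \<Longrightarrow> length bs = length cs"
  by (auto simp: tup_equiv_def dest: map_eq_imp_length_eq)
lemma tup_equiv_mono: "tup_equiv L M B bs cs \<Longrightarrow> A \<subseteq> B \<Longrightarrow> tup_equiv L M A bs cs"
  unfolding tup_equiv_def using fmls_mono[of _ L M A _ B] by blast

lemma tup_equiv_elem_sub:
  assumes "elem_sub L N M" "A \<subseteq> univ N" "bs \<in> lists (univ N)" "cs \<in> lists (univ N)"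
  shows "tup_equiv L N A bs cs = tup_equiv L M A bs cs"
proof -
  have m: "map (sort_of N) bs = map (sort_of M) bs" "map (sort_of N) cs = map (sort_of M) cs"
    using assms elem_subD(4)[OF assms(1)] by (auto simp: in_lists_conv_set)
  have "sat_tup N bs \<psi> = sat_tup M bs \<psi>" "sat_tup N cs \<psi> = sat_tup M cs \<psi>"
    if "map (sort_of M) bs = map (sort_of M) cs" "\<psi> \<in> fmls L M A (map (sort_of M) bs)" for \<psi>
    using sat_elem_sub[OF assms(1,3) fmls_mono[OF that(2) assms(2)]]
      sat_elem_sub[OF assms(1,4), of \<psi>] fmls_mono[OF that(2) assms(2)] that(1) by simp_all
  then show ?thesis
    unfolding tup_equiv_def m fmls_elem_sub[OF assms(1,2)] by blast
qed

lemma tm_val_Dom: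
  assumes "has_sort L M A \<Gamma> t s" "is_model L M" "\<And>i. i < length \<Gamma> \<Longrightarrow> v i \<in> Dom M (\<Gamma> ! i)"
  shows "tm_val M v t \<in> Dom M s"
  using assms(1)
proof (induction rule: has_sort.induct)
  case (has_sort_App f ss s ts)
  then have "list_all2 (\<lambda>a t. a \<in> Dom M t) (map (tm_val M v) ts) ss"
    by (simp add: list_all2_conv_all_nth)
  then show ?case using assms(2) has_sort_App(1) by (simp add: is_model_def)
qed (use assms(3) in \<open>auto simp: Dom_def\<close>)

text \<open>
  Equality of types is preserved by applying the same terms to both tuples, as a formula about the values
  is the formula with these terms substituted. Variables as terms select subtuples; constants adjoin
  parameters.
\<close>

lemma tup_equiv_terms:
  assumes M: "is_model L M" "A \<subseteq> univ M" and e: "tup_equiv L M A bs cs"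
    and bs: "bs \<in> lists (univ M)" and cs: "cs \<in> lists (univ M)"
    and ts: "list_all2 (has_sort L M A (map (sort_of M) bs)) ts ss"
  shows "tup_equiv L M A (map (tm_val M ((!) bs)) ts) (map (tm_val M ((!) cs)) ts)"
proof -
  have m: "map (sort_of M) bs = map (sort_of M) cs" using e by (simp add: tup_equiv_def)
  have D: "tm_val M ((!) xs) (ts ! i) \<in> Dom M (ss ! i)"
    if "i < length ts" "map (sort_of M) xs = map (sort_of M) bs" "xs \<in> lists (univ M)" for i xs
  proof (rule tm_val_Dom[OF _ M(1)])
    show "has_sort L M A (map (sort_of M) xs) (ts ! i) (ss ! i)"
      using ts that by (simp add: list_all2_conv_all_nth)
    have "length xs = length bs" using that(2) by (rule map_eq_imp_length_eq)
    then show "xs ! i \<in> Dom M (map (sort_of M) xs ! i)" if "i < length (map (sort_of M) xs)" for i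
      using that \<open>xs \<in> lists (univ M)\<close> by (simp add: Dom_def in_lists_conv_set)
  qed
  have S: "map (sort_of M) (map (tm_val M ((!) xs)) ts) = ss"
    if "map (sort_of M) xs = map (sort_of M) bs" "xs \<in> lists (univ M)" for xs
    using D[OF _ that] ts by (auto simp: Dom_def list_all2_conv_all_nth list_eq_iff_nth_eq)
  have "sat_tup M (map (tm_val M ((!) bs)) ts) \<psi> = sat_tup M (map (tm_val M ((!) cs)) ts) \<psi>"
    if \<psi>: "\<psi> \<in> fmls L M A ss" for \<psi>
  proof -
    let ?\<sigma> = "\<lambda>i. ts ! i"
    have wf: "wf_fm L M A (map (sort_of M) bs) (subst_fm ?\<sigma> \<psi>)"
      by (rule wf_subst[where A = A and \<Gamma> = ss])
        (use \<psi> ts M in \<open>auto simp: fmls_def list_all2_conv_all_nth\<close>)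
    have "sat_tup M xs (subst_fm ?\<sigma> \<psi>) = sat_tup M (map (tm_val M ((!) xs)) ts) \<psi>" for xs
      unfolding sat_tup_def sat_subst
      by (rule sat_cong[where L = L and M = M and A = A and \<Gamma> = ss])
        (use \<psi> ts in \<open>auto simp: fmls_def list_all2_conv_all_nth\<close>)
    moreover have "sat_tup M bs (subst_fm ?\<sigma> \<psi>) = sat_tup M cs (subst_fm ?\<sigma> \<psi>)"
      using e wf unfolding tup_equiv_def fmls_def by blast
    ultimately show ?thesis by simp
  qed
  then show ?thesis
    unfolding tup_equiv_def using S[of bs] S[of cs] m bs cs by simp
qed

lemma tup_equiv_nths:
  assumes M: "is_model L M" "A \<subseteq> univ M" and e: "tup_equiv L M A bs cs"
    and bs: "bs \<in> lists (univ M)" and cs: "cs \<in> lists (univ M)" and I: "\<forall>i\<in>set I. i < length bs"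
  shows "tup_equiv L M A (map ((!) bs) I) (map ((!) cs) I)"
proof -
  have "list_all2 (has_sort L M A (map (sort_of M) bs)) (map Var I) (map (\<lambda>i. sort_of M (bs ! i)) I)"
    using I has_sort_Var[of _ "map (sort_of M) bs" L M A]
    by (auto simp: list_all2_conv_all_nth)
  from tup_equiv_terms[OF M e bs cs this] show ?thesis by (simp add: comp_def)
qed

lemma tup_equiv_append:
  assumes M: "is_model L M" "A \<subseteq> univ M" and e: "tup_equiv L M A (bs @ bs') cs"
    and l: "bs @ bs' \<in> lists (univ M)" "cs \<in> lists (univ M)"
  obtains ds ds' where "cs = ds @ ds'" "tup_equiv L M A bs ds" "tup_equiv L M A bs' ds'"
proof
  have len: "length cs = length bs + length bs'" using tup_equiv_length[OF e] by simp
  show "cs = take (length bs) cs @ drop (length bs) cs" by simp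
  have "map ((!) (bs @ bs')) [0..<length bs] = bs" by (auto intro: nth_equalityI simp: nth_append)
  moreover have "map ((!) cs) [0..<length bs] = take (length bs) cs"
    using len by (auto intro: nth_equalityI)
  ultimately show "tup_equiv L M A bs (take (length bs) cs)"
    using tup_equiv_nths[OF M e l, of "[0..<length bs]"] by simp
  have "map ((!) (bs @ bs')) [length bs..<length bs + length bs'] = bs'"
    by (auto intro: nth_equalityI simp: nth_append)
  moreover have "map ((!) cs) [length bs..<length bs + length bs'] = drop (length bs) cs"
    using len by (auto intro: nth_equalityI)
  ultimately show "tup_equiv L M A bs' (drop (length bs) cs)"
    using tup_equiv_nths[OF M e l, of "[length bs..<length bs + length bs']"] by simp
qed

lemma tup_equiv_add_params:
  assumes M: "is_model L M" "A \<subseteq> univ M" and e: "tup_equiv L M A [d] [d']"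
    and l: "d \<in> univ M" "d' \<in> univ M" "set cs \<subseteq> A"
  shows "tup_equiv L M A (d # cs) (d' # cs)"
proof -
  have "list_all2 (has_sort L M A (map (sort_of M) [d])) (Var 0 # map Par cs) (sort_of M d # map (sort_of M) cs)"
    using l M(2) has_sort_Var[of 0 "[sort_of M d]" L M A]
    by (auto simp: list.rel_map list_all2_same intro: has_sort_Par)
  from tup_equiv_terms[OF M e _ _ this] l show ?thesis by (simp add: comp_def)
qed

section \<open>Complete types\<close>

lemma types_subset: "p \<in> types L M s A \<Longrightarrow> p \<subseteq> fmls L M A [s]"
  by (simp add: types_def)

lemma types_complete: "p \<in> types L M s A \<Longrightarrow> \<phi> \<in> fmls L M A [s] \<Longrightarrow> \<phi> \<in> p \<or> Neg \<phi> \<in> p"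
  by (simp add: types_def)

lemma types_finsat:
  assumes "p \<in> types L M s A" "F \<subseteq> p" "finite F"
  shows "\<exists>a \<in> Dom M s. \<forall>\<phi> \<in> F. sat_tup M [a] \<phi>"
  using assms unfolding types_def by simp

text \<open>A type contains every consequence of its finite parts, as otherwise it would contain the negation.\<close>

lemma types_closed:
  assumes p: "p \<in> types L M s A" and F: "F \<subseteq> p" "finite F" and \<psi>: "\<psi> \<in> fmls L M A [s]"
    and imp: "\<And>a. a \<in> Dom M s \<Longrightarrow> \<forall>\<phi>\<in>F. sat_tup M [a] \<phi> \<Longrightarrow> sat_tup M [a] \<psi>"
  shows "\<psi> \<in> p"
proof (rule ccontr)
  assume "\<psi> \<notin> p"
  then have "Neg \<psi> \<in> p" using types_complete[OF p \<psi>] by simp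
  then obtain a where "a \<in> Dom M s" "\<forall>\<phi> \<in> insert (Neg \<psi>) F. sat_tup M [a] \<phi>"
    using types_finsat[OF p, of "insert (Neg \<psi>) F"] F by auto
  then show False using imp[of a] by simp
qed

lemma types_closed1:
  assumes p: "p \<in> types L M s A" and "\<phi> \<in> p" and \<psi>: "\<psi> \<in> fmls L M A [s]"
    and imp: "\<And>a. a \<in> Dom M s \<Longrightarrow> sat_tup M [a] \<phi> \<Longrightarrow> sat_tup M [a] \<psi>"
  shows "\<psi> \<in> p"
  by (rule types_closed[OF p, of "{\<phi>}"]) (use assms in auto)

lemma types_Neg_iff:
  assumes p: "p \<in> types L M s A" and \<phi>: "\<phi> \<in> fmls L M A [s]"
  shows "Neg \<phi> \<in> p \<longleftrightarrow> \<phi> \<notin> p"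
proof -
  have "\<not> (\<phi> \<in> p \<and> Neg \<phi> \<in> p)"
  proof
    assume "\<phi> \<in> p \<and> Neg \<phi> \<in> p"
    then show False using types_finsat[OF p, of "{\<phi>, Neg \<phi>}"] by simp
  qed
  then show ?thesis using types_complete[OF p \<phi>] by blast
qed

lemma types_eq:
  assumes "p \<in> types L M s A" "q \<in> types L M s A" "p \<subseteq> q"
  shows "p = q"
  using assms types_Neg_iff[OF assms(1)] types_Neg_iff[OF assms(2)] types_subset[OF assms(2)] by blast

lemma types_restrict:
  assumes "p \<in> types L M s B" "A \<subseteq> B"
  shows "p \<inter> fmls L M A [s] \<in> types L M s A"
  unfolding types_def mem_Collect_eq
proof (intro conjI ballI allI impI)
  fix \<phi> assume \<phi>: "\<phi> \<in> fmls L M A [s]"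
  then show "\<phi> \<in> p \<inter> fmls L M A [s] \<or> Neg \<phi> \<in> p \<inter> fmls L M A [s]"
    using types_complete[OF assms(1) fmls_mono[OF \<phi> assms(2)]] by simp
next
  fix F assume "F \<subseteq> p \<inter> fmls L M A [s]" "finite F"
  then show "\<exists>a\<in>Dom M s. \<forall>\<phi>\<in>F. sat_tup M [a] \<phi>"
    using types_finsat[OF assms(1), of F] by auto
qed auto

lemma typesI:
  assumes p: "p \<subseteq> fmls L M A [s]"
    and c: "\<And>\<phi>. \<phi> \<in> fmls L M A [s] \<Longrightarrow> \<phi> \<in> p \<or> Neg \<phi> \<in> p"
    and f: "\<And>fs. set fs \<subseteq> p \<Longrightarrow> \<exists>a\<in>Dom M s. sat_tup M [a] (conj_list fs)"
  shows "p \<in> types L M s A"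
  unfolding types_def mem_Collect_eq
proof (intro conjI ballI allI impI p)
  fix F assume F: "F \<subseteq> p" "finite F"
  from finite_list[OF F(2)] obtain fs where "set fs = F" by auto
  with f[of fs] F(1) show "\<exists>a\<in>Dom M s. \<forall>\<phi>\<in>F. sat_tup M [a] \<phi>"
    by (simp add: sat_conj_list)
qed (rule c)

lemma conj_list_in_type:
  assumes "p \<in> types L M s A" "set fs \<subseteq> p"
  shows "conj_list fs \<in> p"
proof (rule types_closed[OF assms(1) assms(2)])
  show "conj_list fs \<in> fmls L M A [s]"
    using assms(2) types_subset[OF assms(1)] by (simp add: conj_list_fmls)
qed (auto simp: sat_conj_list)

text \<open>Finite satisfiability of a set of formulas over \<open>A\<close> is a set of existential sentences over \<open>A\<close>, on
  which \<open>M\<close> and \<open>M'\<close> agree.\<close>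

lemma types_elem_sub:
  assumes e: "elem_sub L M M'" and A: "A \<subseteq> univ M"
  shows "types L M s A = types L M' s A"
proof -
  have *: "(\<exists>a\<in>Dom M s. \<forall>\<phi>\<in>F. sat_tup M [a] \<phi>) = (\<exists>a\<in>Dom M' s. \<forall>\<phi>\<in>F. sat_tup M' [a] \<phi>)"
    if F: "F \<subseteq> fmls L M' A [s]" "finite F" for F
  proof -
    obtain fs where fs: "set fs = F" using finite_list[OF F(2)] by auto
    then have "conj_list fs \<in> fmls L M' (univ M) [s]"
      using F(1) by (intro fmls_mono[OF _ A]) (simp add: conj_list_fmls)
    from Dom_ex_elem_sub[OF e, of "[]" "conj_list fs" s] this show ?thesis
      by (simp add: sat_conj_list fs)
  qed
  have "p \<in> types L M s A \<longleftrightarrow> p \<in> types L M' s A" for p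
    using * unfolding types_def fmls_elem_sub[OF e A] mem_Collect_eq
    by (meson order_trans)
  then show ?thesis by blast
qed

lemma realizations_iff:
  assumes "p \<in> types L M s A" "a \<in> realizations M s p" "\<phi> \<in> fmls L M A [s]"
  shows "\<phi> \<in> p \<longleftrightarrow> sat_tup M [a] \<phi>"
  using assms types_Neg_iff[OF assms(1,3)] unfolding realizations_def by (metis (no_types, lifting) mem_Collect_eq sat_tup_simps(2))

lemma realizations_equiv:
  assumes "p \<in> types L M s A" "a \<in> realizations M s p" "b \<in> realizations M s p"
  shows "tup_equiv L M A [a] [b]"
  unfolding tup_equiv_def
  using assms realizations_iff[OF assms(1,2)] realizations_iff[OF assms(1,3)]
  by (auto simp: realizations_def Dom_def)

lemma tp_types:
  assumes "a \<in> Dom M (gsort L)" shows "tp L M a A \<in> types_x L M A"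
  unfolding types_def tp_def using assms by auto

lemma inv_types_types: "p \<in> inv_types L M G \<Longrightarrow> p \<in> types_x L M (univ M)"
  by (simp add: inv_types_def)

lemma inv_typesD:
  assumes "p \<in> inv_types L M G" "bs \<in> lists (univ M)" "bs' \<in> lists (univ M)"
    "tup_equiv L M (univ G) bs bs'" "\<phi> \<in> fmls L M (univ G) (gsort L # map (sort_of M) bs)"
  shows "inst_pars bs \<phi> \<in> p \<longleftrightarrow> inst_pars bs' \<phi> \<in> p"
  using assms unfolding inv_types_def by blast

lemma inst_conj_list:
  "inst_pars bs (conj_list fs) = conj_list (map (inst_pars bs) fs)"
  by (induction fs) (simp_all add: conj_list_def inst_pars_def)

section \<open>Saturation\<close>

lemma small_Un_finite:
  assumes "Card_order \<kappa>" "small \<kappa> A" "\<not> finite (Field \<kappa>)" "finite B"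
  shows "small \<kappa> (A \<union> B)"
proof -
  have "Well_order \<kappa>" using assms(1) unfolding card_order_on_def by blast
  then have "(card_of B, \<kappa>) \<in> ordLess"
    using finite_ordLess_infinite[OF card_of_Well_order, of \<kappa> B] assms by (simp add: Field_card_of)
  then show ?thesis using assms card_of_Un_ordLess_infinite_Field[of \<kappa> A B] by (simp add: small_def)
qed

text \<open>Iterated negations of a sentence are distinct, so the cardinal bounding small sets is infinite.\<close>

lemma infinite_fmls:
  fixes M :: "('s, 'f, 'r, 'a) model"
  shows "infinite (\<Union>\<Gamma>. fmls L M {} \<Gamma>)"
proof
  assume fin: "finite (\<Union>\<Gamma>. fmls L M {} \<Gamma>)"
  have "(Neg ^^ n) Fls \<in> fmls L M {} []" for n by (induction n) simp_all
  then have "(Neg ^^ n) Fls \<in> (\<Union>\<Gamma>. fmls L M {} \<Gamma>)" for n by (rule UN_I[OF UNIV_I])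
  then have f: "finite (range (\<lambda>n. (Neg ^^ n) (Fls :: ('s, 'f, 'r, 'a) fm)))"
    using finite_subset[OF _ fin] by (simp add: image_subset_iff)
  have "inj (\<lambda>n. (Neg ^^ n) (Fls :: ('s, 'f, 'r, 'a) fm))"
  proof (rule injI)
    fix m n assume "(Neg ^^ m) (Fls :: ('s, 'f, 'r, 'a) fm) = (Neg ^^ n) Fls"
    then show "m = n"
    proof (induction m arbitrary: n)
      case 0 then show ?case by (cases n) auto
    next
      case (Suc m) then show ?case by (cases n) auto
    qed
  qed
  then show False using f finite_imageD by blast
qed

lemma monsterD:
  fixes M :: "('s, 'f, 'r, 'a) model"
  assumes "monster L T \<kappa> M"
  shows "is_model L M" "Card_order \<kappa>" "small \<kappa> (\<Union>\<Gamma>. fmls L M {} \<Gamma>)" "\<not> finite (Field \<kappa>)"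
    "A \<subseteq> univ M \<Longrightarrow> small \<kappa> A \<Longrightarrow> p \<in> types L M s A \<Longrightarrow> realizations M s p \<noteq> {}"
proof -
  show 1: "is_model L M" "Card_order \<kappa>" "small \<kappa> (\<Union>\<Gamma>. fmls L M {} \<Gamma>)"
    "A \<subseteq> univ M \<Longrightarrow> small \<kappa> A \<Longrightarrow> p \<in> types L M s A \<Longrightarrow> realizations M s p \<noteq> {}"
    using assms unfolding monster_def by blast+
  show "\<not> finite (Field \<kappa>)"
    using infinite_fmls[of L M] 1(3) card_of_ordLeq_infinite[of "\<Union>\<Gamma>. fmls L M {} \<Gamma>" "Field \<kappa>"]
      card_of_Field_ordIso[OF 1(2)] ordLess_imp_ordLeq ordIso_symmetric ordLeq_ordIso_trans
    unfolding small_def by metis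
qed

text \<open>
  Saturation is assumed for types in one variable over small subsets of \<open>M\<close>; it is used here for tuples,
  whose types over \<open>A\<close> are given by a tuple of an elementary extension. The elements are realized one by
  one: once \<open>cs\<close> matches \<open>bs\<close>, the next element has to realize the type of \<open>b\<close> over \<open>A\<close> and \<open>bs\<close>,
  transported to \<open>A\<close> and \<open>cs\<close>.
\<close>

lemma monster_realizes_tuple:
  assumes M: "monster L T \<kappa> M" and e: "elem_sub L M M'"
    and A: "A \<subseteq> univ M" "small \<kappa> A" and bs: "bs \<in> lists (univ M')"
  obtains cs where "cs \<in> lists (univ M)" "tup_equiv L M' A bs cs"
proof -
  note mM = monsterD[OF M]
  have "\<exists>cs. cs \<in> lists (univ M) \<and> tup_equiv L M' A bs cs"
    using bs
  proof (induction bs rule: list.induct)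
    case Nil
    then show ?case using tup_equiv_refl by (intro exI[of _ "[]"]) auto
  next
    case (Cons b bs)
    then obtain cs where cs: "cs \<in> lists (univ M)" and eq: "tup_equiv L M' A bs cs" by auto
    let ?s = "sort_of M' b" and ?\<Gamma> = "map (sort_of M') cs"
    have sorts: "map (sort_of M') bs = ?\<Gamma>" using eq by (simp add: tup_equiv_def)
    have sortsM: "map (sort_of M) cs = ?\<Gamma>" using cs elem_subD(4)[OF e] by auto
    have Asub: "A \<union> set cs \<subseteq> univ M" using A cs by auto
    have fA: "fmls L M A \<Gamma> = fmls L M' A \<Gamma>" for \<Gamma> using fmls_elem_sub[OF e A(1)] .
    define p where "p = {inst_pars cs \<psi> | \<psi>. \<psi> \<in> fmls L M A (?s # ?\<Gamma>) \<and> sat_tup M' (b # bs) \<psi>}"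
    have "p \<in> types L M ?s (A \<union> set cs)"
    proof (rule typesI)
      show "p \<subseteq> fmls L M (A \<union> set cs) [?s]"
        using inst_pars_fmls[OF _ order_refl Asub] sortsM by (auto simp: p_def)
      fix \<phi> assume "\<phi> \<in> fmls L M (A \<union> set cs) [?s]"
      then obtain \<psi> where \<psi>: "\<psi> \<in> fmls L M A (?s # ?\<Gamma>)" "inst_pars cs \<psi> = \<phi>"
        using fmls_abstract1 sortsM by metis
      then have N: "inst_pars cs (Neg \<psi>) = Neg \<phi>" by (simp add: inst_pars_def)
      show "\<phi> \<in> p \<or> Neg \<phi> \<in> p"
      proof (cases "sat_tup M' (b # bs) \<psi>")
        case True then show ?thesis using \<psi> by (auto simp: p_def)
      next
        case False
        then have "Neg \<psi> \<in> fmls L M A (?s # ?\<Gamma>)" "sat_tup M' (b # bs) (Neg \<psi>)" using \<psi> by simp_all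
        then show ?thesis unfolding p_def N[symmetric] by blast
      qed
    next
      fix fs assume "set fs \<subseteq> p"
      then have "\<forall>\<phi>\<in>set fs. \<exists>\<psi>. \<phi> = inst_pars cs \<psi> \<and> \<psi> \<in> fmls L M A (?s # ?\<Gamma>) \<and> sat_tup M' (b # bs) \<psi>"
        by (auto simp: p_def)
      then obtain h where h: "\<And>\<phi>. \<phi> \<in> set fs \<Longrightarrow> \<phi> = inst_pars cs (h \<phi>) \<and> h \<phi> \<in> fmls L M A (?s # ?\<Gamma>) \<and> sat_tup M' (b # bs) (h \<phi>)"
        by metis
      let ?\<psi> = "conj_list (map h fs)"
      have \<psi>: "?\<psi> \<in> fmls L M A (?s # ?\<Gamma>)" using h by (auto simp: conj_list_fmls)
      have "conj_list fs = inst_pars cs ?\<psi>"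
        unfolding inst_conj_list map_map using h by (simp add: map_idI)
      have "sat_tup M' (b # bs) ?\<psi>" using h by (auto simp: sat_conj_list)
      then have "sat_tup M' bs (Exi ?s ?\<psi>)"
        unfolding sat_tup_simps using Cons.prems by (intro bexI[of _ b]) (auto simp: Dom_def)
      moreover have "Exi ?s ?\<psi> \<in> fmls L M' A ?\<Gamma>" using \<psi> fA by simp
      ultimately have "sat_tup M' cs (Exi ?s ?\<psi>)" using eq sorts unfolding tup_equiv_def by metis
      then have "sat_tup M cs (Exi ?s ?\<psi>)"
        using Dom_ex_elem_sub[OF e cs, of ?\<psi> ?s] \<psi> fA fmls_mono[OF _ A(1)] sat_tup_simps(5) by metis
      then show "\<exists>a\<in>Dom M ?s. sat_tup M [a] (conj_list fs)"
        unfolding \<open>conj_list fs = inst_pars cs ?\<psi>\<close> by (simp add: sat_tup_inst_pars)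
    qed
    then obtain c where c: "c \<in> realizations M ?s p"
      using mM(5)[OF Asub] small_Un_finite[OF mM(2) A(2) mM(4), of "set cs"] by auto
    then have cD: "c \<in> Dom M ?s" by (simp add: realizations_def)
    have cU: "c \<in> univ M" "c \<in> univ M'" "sort_of M' c = ?s"
      using cD elem_subD(3,4)[OF e] by (auto simp: Dom_def)
    have imp: "sat_tup M' (c # cs) \<psi>" if \<psi>: "\<psi> \<in> fmls L M' A (?s # ?\<Gamma>)" "sat_tup M' (b # bs) \<psi>" for \<psi>
    proof -
      have "inst_pars cs \<psi> \<in> p" using \<psi> fA by (auto simp: p_def)
      then have "sat_tup M (c # cs) \<psi>" using c by (auto simp: realizations_def sat_tup_inst_pars)
      moreover have "\<psi> \<in> fmls L M' (univ M) (map (sort_of M') (c # cs))"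
        using \<psi>(1) cU fmls_mono[OF _ A(1)] by simp
      ultimately show ?thesis using sat_elem_sub[OF e, of "c # cs" \<psi>] cU cs by simp
    qed
    have "tup_equiv L M' A (b # bs) (c # cs)"
      unfolding tup_equiv_def
    proof (intro conjI ballI)
      show "map (sort_of M') (b # bs) = map (sort_of M') (c # cs)" using sorts cU by simp
      fix \<psi> assume "\<psi> \<in> fmls L M' A (map (sort_of M') (b # bs))"
      then have "\<psi> \<in> fmls L M' A (?s # ?\<Gamma>)" by (simp add: sorts)
      then show "sat_tup M' (b # bs) \<psi> = sat_tup M' (c # cs) \<psi>"
        using imp[of \<psi>] imp[of "Neg \<psi>"] by auto
    qed
    then show ?case using cs cU by (intro exI[of _ "c # cs"]) auto
  qed
  then show ?thesis using that by blast
qed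

section \<open>The invariant extension of an invariant type\<close>

lemma sat_tup_append:
  assumes "\<psi> \<in> fmls L M A (s # \<Gamma>)" "length xs = length \<Gamma>"
  shows "sat_tup K (a # xs @ ys) \<psi> = sat_tup K (a # xs) \<psi>"
  unfolding sat_tup_def
proof (rule sat_cong)
  show "wf_fm L M A (s # \<Gamma>) \<psi>" using assms by (simp add: fmls_def)
  show "(a # xs @ ys) ! i = (a # xs) ! i" if "i < length (s # \<Gamma>)" for i
    using that assms(2) nth_append[of "a # xs" ys i] by simp
qed

text \<open>Used to express two formulas about different tuples by formulas about the concatenated tuple.\<close>

lemma ex_shifted_fm:
  fixes \<psi> :: "('s, 'f, 'r, 'a) fm"
  assumes \<psi>: "\<psi> \<in> fmls L M A (s # \<Gamma>')" and A: "A \<subseteq> univ M"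
  shows "\<exists>\<psi>' \<in> fmls L M A (s # \<Gamma> @ \<Gamma>').
    \<forall>a xs ys. length xs = length \<Gamma> \<longrightarrow> sat_tup M (a # xs @ ys) \<psi>' = sat_tup M (a # ys) \<psi>"
proof (intro bexI allI impI)
  let ?\<sigma> = "case_nat (Var 0) (\<lambda>i. Var (Suc (i + length \<Gamma>))) :: nat \<Rightarrow> ('f, 'a) tm"
  show "subst_fm ?\<sigma> \<psi> \<in> fmls L M A (s # \<Gamma> @ \<Gamma>')"
    unfolding fmls_def mem_Collect_eq
  proof (rule wf_subst)
    show "wf_fm L M A (s # \<Gamma>') \<psi>" using \<psi> by (simp add: fmls_def)
    fix i assume "i < length (s # \<Gamma>')"
    then show "has_sort L M A (s # \<Gamma> @ \<Gamma>') (?\<sigma> i) ((s # \<Gamma>') ! i)"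
      using has_sort_Var[of 0 "s # \<Gamma> @ \<Gamma>'" L M A]
        has_sort_Var[of "i + length \<Gamma>" "s # \<Gamma> @ \<Gamma>'" L M A]
      by (cases i) (simp_all add: nth_append)
  qed (use A in auto)
  fix a and xs ys :: "'a list" assume len: "length xs = length \<Gamma>"
  have "(\<lambda>i. tm_val M ((!) (a # xs @ ys)) (?\<sigma> i)) = (!) (a # ys)"
  proof
    fix i show "tm_val M ((!) (a # xs @ ys)) (?\<sigma> i) = (a # ys) ! i"
      using len by (cases i) (simp_all add: nth_append)
  qed
  then show "sat_tup M (a # xs @ ys) (subst_fm ?\<sigma> \<psi>) = sat_tup M (a # ys) \<psi>"
    by (simp add: sat_tup_def sat_subst)
qed

text \<open>
  The extension of \<open>p\<close> to \<open>M'\<close>: the membership of \<open>\<psi>(x; b')\<close> is decided at a tuple \<open>b\<close> of \<open>M\<close> with the same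
  type over \<open>G\<close> as \<open>b'\<close>.
\<close>

definition transfer_type where
  "transfer_type L M M' G p = {inst_pars bs' \<psi> | bs' bs \<psi>.
     bs' \<in> lists (univ M') \<and> bs \<in> lists (univ M) \<and> tup_equiv L M' (univ G) bs' bs \<and>
     \<psi> \<in> fmls L M' (univ G) (gsort L # map (sort_of M') bs') \<and> inst_pars bs \<psi> \<in> p}"

locale invariant_type =
  fixes L :: "('s, 'f, 'r) lang" and T :: "('s, 'f, 'r, 'a) fm set" and \<kappa> :: "'k rel"
    and M G M' :: "('s, 'f, 'r, 'a) model" and p :: "('s, 'f, 'r, 'a) fm set"
  assumes M: "monster L T \<kappa> M" and GM: "elem_sub L G M" and G: "small \<kappa> (univ G)"
    and MM': "elem_sub L M M'" and p: "p \<in> inv_types L M G"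
begin

abbreviation "gs \<equiv> gsort L"
abbreviation "p' \<equiv> transfer_type L M M' G p"

lemma subs: "univ G \<subseteq> univ M" "univ G \<subseteq> univ M'" "univ M \<subseteq> univ M'" "is_model L M" "is_model L M'"
  using elem_subD[OF GM] elem_subD[OF MM'] by auto

lemma fmls_G: "fmls L M (univ G) \<Gamma> = fmls L M' (univ G) \<Gamma>"
  by (rule fmls_elem_sub[OF MM' subs(1)])

lemma sort_M: "bs \<in> lists (univ M) \<Longrightarrow> map (sort_of M) bs = map (sort_of M') bs"
  using elem_subD(4)[OF MM'] by auto

lemma sorts_eq: "tup_equiv L M' A bs bs' \<Longrightarrow> map (sort_of M') bs = map (sort_of M') bs'"
  by (simp add: tup_equiv_def)

lemma realize:
  assumes "bs' \<in> lists (univ M')"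
  obtains bs where "bs \<in> lists (univ M)" "tup_equiv L M' (univ G) bs' bs"
  using monster_realizes_tuple[OF M MM' subs(1) G assms] by blast

lemma p_invariant:
  assumes "bs \<in> lists (univ M)" "cs \<in> lists (univ M)" "tup_equiv L M' (univ G) bs cs"
    "\<psi> \<in> fmls L M' (univ G) (gs # map (sort_of M') bs)"
  shows "inst_pars bs \<psi> \<in> p \<longleftrightarrow> inst_pars cs \<psi> \<in> p"
  using inv_typesD[OF p assms(1,2)] tup_equiv_elem_sub[OF MM' subs(1) assms(1,2)] assms
  by (simp add: sort_M fmls_G)

lemma inst_pars_fmls_M:
  assumes "bs \<in> lists (univ M)" "\<psi> \<in> fmls L M' (univ G) (gs # map (sort_of M') bs)"
  shows "inst_pars bs \<psi> \<in> fmls_x L M (univ M)"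
proof (rule inst_pars_fmls)
  show "\<psi> \<in> fmls L M (univ G) (gs # map (sort_of M) bs)"
    using assms(2) by (simp add: fmls_G sort_M[OF assms(1)])
qed (use assms(1) subs(1) in auto)

lemma sat_M:
  assumes "bs \<in> lists (univ M)" "\<psi> \<in> fmls L M' (univ G) (gs # map (sort_of M') bs)" "a \<in> Dom M gs"
  shows "sat_tup M (a # bs) \<psi> = sat_tup M' (a # bs) \<psi>"
proof (rule sat_elem_sub[OF MM'])
  have "a \<in> univ M" "sort_of M' a = gs" using assms(3) elem_subD(4)[OF MM'] by (auto simp: Dom_def)
  then show "a # bs \<in> lists (univ M)" "\<psi> \<in> fmls L M' (univ M) (map (sort_of M') (a # bs))"
    using assms fmls_mono[OF assms(2) subs(1)] by auto
qed

text \<open>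
  The key fact about \<open>transfer_type\<close>. An implication between \<open>\<psi>1(x; b1')\<close> and \<open>\<psi>2(x; b2')\<close> is a property of the
  joint type of \<open>b1'\<close> and \<open>b2'\<close> over \<open>G\<close>, whereas \<open>b1\<close> and \<open>b2\<close> were chosen separately. So a tuple \<open>ds @ ds'\<close> of
  \<open>M\<close> with the joint type is chosen; invariance of \<open>p\<close> leads from \<open>b1\<close> to \<open>ds\<close>, the implication, which now
  holds in \<open>M\<close>, from \<open>ds\<close> to \<open>ds'\<close>, and invariance again from \<open>ds'\<close> to \<open>b2\<close>.
\<close>

lemma transfer_imp:
  assumes b': "bs1' \<in> lists (univ M')" "bs2' \<in> lists (univ M')"
    and b: "bs1 \<in> lists (univ M)" "bs2 \<in> lists (univ M)"
    and e: "tup_equiv L M' (univ G) bs1' bs1" "tup_equiv L M' (univ G) bs2' bs2"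
    and \<psi>: "\<psi>1 \<in> fmls L M' (univ G) (gs # map (sort_of M') bs1')"
      "\<psi>2 \<in> fmls L M' (univ G) (gs # map (sort_of M') bs2')"
    and in_p: "inst_pars bs1 \<psi>1 \<in> p"
    and imp: "\<And>a. a \<in> Dom M' gs \<Longrightarrow> sat_tup M' (a # bs1') \<psi>1 \<Longrightarrow> sat_tup M' (a # bs2') \<psi>2"
  shows "inst_pars bs2 \<psi>2 \<in> p"
proof -
  let ?\<Gamma>1 = "map (sort_of M') bs1'" and ?\<Gamma>2 = "map (sort_of M') bs2'"
  obtain cs where cs: "cs \<in> lists (univ M)" "tup_equiv L M' (univ G) (bs1' @ bs2') cs"
    using realize[of "bs1' @ bs2'"] b' by auto
  have csM': "cs \<in> lists (univ M')" using cs(1) subs(3) by auto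
  obtain ds ds' where d: "cs = ds @ ds'" "tup_equiv L M' (univ G) bs1' ds" "tup_equiv L M' (univ G) bs2' ds'"
    using tup_equiv_append[OF subs(5,2) cs(2) _ csM'] b' by auto
  have dM: "ds \<in> lists (univ M)" "ds' \<in> lists (univ M)" using cs(1) d(1) by auto
  have s1: "?\<Gamma>1 = map (sort_of M') ds" "?\<Gamma>2 = map (sort_of M') ds'"
    "map (sort_of M') bs1 = ?\<Gamma>1" "map (sort_of M') bs2 = ?\<Gamma>2"
    using sorts_eq[OF d(2)] sorts_eq[OF d(3)] sorts_eq[OF e(1)] sorts_eq[OF e(2)] by simp_all
  have len: "length ds = length bs1'" using d(2) tup_equiv_length by metis
  have "inst_pars ds \<psi>1 \<in> p"
    using p_invariant[OF b(1) dM(1), of \<psi>1] tup_equiv_trans[OF tup_equiv_sym[OF e(1)] d(2)] \<psi>(1) in_p s1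
    by simp
  obtain \<psi>2' where \<psi>2': "\<psi>2' \<in> fmls L M' (univ G) (gs # ?\<Gamma>1 @ ?\<Gamma>2)"
    "\<forall>a xs ys. length xs = length ?\<Gamma>1 \<longrightarrow> sat_tup M' (a # xs @ ys) \<psi>2' = sat_tup M' (a # ys) \<psi>2"
    using ex_shifted_fm[OF \<psi>(2) subs(2), of ?\<Gamma>1] by blast
  \<comment> \<open>the joint type of the two tuples forbids a counterexample to the implication\<close>
  let ?\<chi> = "Exi gs (And \<psi>1 (Neg \<psi>2'))"
  have "\<psi>1 \<in> fmls L M' (univ G) (gs # ?\<Gamma>1 @ ?\<Gamma>2)"
    using fmls_append[OF \<psi>(1) subs(2), of ?\<Gamma>2] by simp
  then have "?\<chi> \<in> fmls L M' (univ G) (map (sort_of M') (bs1' @ bs2'))"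
    using \<psi>2'(1) by simp
  moreover have \<chi>: "sat_tup M' (xs @ ys) ?\<chi> \<longleftrightarrow> (\<exists>a\<in>Dom M' gs. sat_tup M' (a # xs) \<psi>1 \<and> \<not> sat_tup M' (a # ys) \<psi>2)"
    if "length xs = length bs1'" for xs ys
    using \<psi>2'(2) sat_tup_append[OF \<psi>(1), of xs] that by simp
  ultimately have "\<not> sat_tup M' (ds @ ds') ?\<chi>"
    using cs(2) imp \<chi>[of bs1' bs2'] unfolding d(1) tup_equiv_def by blast
  then have "\<And>a. a \<in> Dom M' gs \<Longrightarrow> sat_tup M' (a # ds) \<psi>1 \<Longrightarrow> sat_tup M' (a # ds') \<psi>2"
    using \<chi>[OF len] by blast
  moreover have "sat_tup M (a # ds) \<psi>1 = sat_tup M' (a # ds) \<psi>1"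
    "sat_tup M (a # ds') \<psi>2 = sat_tup M' (a # ds') \<psi>2" if "a \<in> Dom M gs" for a
    using sat_M[OF dM(1) _ that, of \<psi>1] sat_M[OF dM(2) _ that, of \<psi>2] \<psi> s1 by simp_all
  ultimately have "\<And>a. a \<in> Dom M gs \<Longrightarrow> sat_tup M (a # ds) \<psi>1 \<Longrightarrow> sat_tup M (a # ds') \<psi>2"
    using elem_subD(5)[OF MM', of gs] by blast
  then have "inst_pars ds' \<psi>2 \<in> p"
    using inst_pars_fmls_M[OF dM(2), of \<psi>2] \<psi>(2) s1(2)
    by (intro types_closed1[OF inv_types_types[OF p] \<open>inst_pars ds \<psi>1 \<in> p\<close>]) (auto simp: sat_tup_inst_pars)
  then show ?thesis
    using p_invariant[OF dM(2) b(2), of \<psi>2] tup_equiv_trans[OF tup_equiv_sym[OF d(3)] e(2)] \<psi>(2) s1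
    by simp
qed

text \<open>Membership does not depend on the way a formula is written with parameters nor on the matching tuple.\<close>

lemma transfer_iff:
  assumes "bs' \<in> lists (univ M')" "bs \<in> lists (univ M)" "tup_equiv L M' (univ G) bs' bs"
    and "\<psi> \<in> fmls L M' (univ G) (gs # map (sort_of M') bs')"
  shows "inst_pars bs' \<psi> \<in> p' \<longleftrightarrow> inst_pars bs \<psi> \<in> p"
proof
  show "inst_pars bs \<psi> \<in> p \<Longrightarrow> inst_pars bs' \<psi> \<in> p'"
    using assms unfolding transfer_type_def by blast
  assume "inst_pars bs' \<psi> \<in> p'"
  then obtain cs' cs \<theta> where c: "inst_pars bs' \<psi> = inst_pars cs' \<theta>"
    "cs' \<in> lists (univ M')" "cs \<in> lists (univ M)" "tup_equiv L M' (univ G) cs' cs"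
    "\<theta> \<in> fmls L M' (univ G) (gsort L # map (sort_of M') cs')" "inst_pars cs \<theta> \<in> p"
    unfolding transfer_type_def by blast
  show "inst_pars bs \<psi> \<in> p"
  proof (rule transfer_imp[OF c(2) assms(1) c(3) assms(2) c(4) assms(3) c(5) assms(4) c(6)])
    show "sat_tup M' (a # bs') \<psi>" if "sat_tup M' (a # cs') \<theta>" for a
      using that c(1) by (metis sat_tup_inst_pars)
  qed
qed

text \<open>
  Finitely many formulas are written with one common parameter tuple, so that a single tuple of \<open>M\<close>
  decides them all.
\<close>

lemma represent_fms:
  assumes "set fs \<subseteq> fmls_x L M' (univ M')"
  obtains bs' bs h where "bs' \<in> lists (univ M')" "bs \<in> lists (univ M)" "tup_equiv L M' (univ G) bs' bs"
    "\<forall>\<phi>\<in>set fs. h \<phi> \<in> fmls L M' (univ G) (gs # map (sort_of M') bs') \<and> inst_pars bs' (h \<phi>) = \<phi>"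
proof -
  have "finite (\<Union>\<phi>\<in>set fs. set4_fm \<phi>)" by (simp add: finite_params)
  from finite_list[OF this] obtain bs' where bs': "set bs' = (\<Union>\<phi>\<in>set fs. set4_fm \<phi>)" by auto
  then have bs'': "bs' \<in> lists (univ M')" using params_subset assms by fastforce
  have "\<exists>\<psi>. \<psi> \<in> fmls L M' (univ G) (gs # map (sort_of M') bs') \<and> inst_pars bs' \<psi> = \<phi>"
    if "\<phi> \<in> set fs" for \<phi>
  proof -
    have "\<phi> \<in> fmls_x L M' (set4_fm \<phi>)" by (rule fmls_params) (use assms that in auto)
    then have "\<phi> \<in> fmls_x L M' (univ G \<union> set bs')" by (rule fmls_mono) (use bs' that in auto)
    then show ?thesis by (rule fmls_abstract1) auto
  qed
  then have "\<forall>\<phi>\<in>set fs. \<exists>\<psi>. \<psi> \<in> fmls L M' (univ G) (gs # map (sort_of M') bs') \<and> inst_pars bs' \<psi> = \<phi>"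
    by blast
  then obtain h where "\<forall>\<phi>\<in>set fs. h \<phi> \<in> fmls L M' (univ G) (gs # map (sort_of M') bs') \<and> inst_pars bs' (h \<phi>) = \<phi>"
    unfolding bchoice_iff by blast
  moreover obtain bs where "bs \<in> lists (univ M)" "tup_equiv L M' (univ G) bs' bs"
    using realize[OF bs''] .
  ultimately show ?thesis using that bs'' by blast
qed

lemma represent_fm:
  assumes "\<phi> \<in> fmls_x L M' (univ M')"
  obtains bs' bs \<psi> where "bs' \<in> lists (univ M')" "bs \<in> lists (univ M)" "tup_equiv L M' (univ G) bs' bs"
    "\<psi> \<in> fmls L M' (univ G) (gs # map (sort_of M') bs')" "inst_pars bs' \<psi> = \<phi>"
  by (rule represent_fms[of "[\<phi>]"]) (use assms that in auto)

lemma transfer_types: "p' \<in> types_x L M' (univ M')"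
proof (rule typesI)
  show sub: "p' \<subseteq> fmls_x L M' (univ M')"
    using inst_pars_fmls[of _ L M' "univ G" gs _ "univ M'"] subs(2) by (auto simp: transfer_type_def)
  fix \<phi> assume "\<phi> \<in> fmls_x L M' (univ M')"
  then obtain bs' bs \<psi> where b: "bs' \<in> lists (univ M')" "bs \<in> lists (univ M)" "tup_equiv L M' (univ G) bs' bs"
    "\<psi> \<in> fmls L M' (univ G) (gs # map (sort_of M') bs')" "inst_pars bs' \<psi> = \<phi>" by (rule represent_fm)
  have N: "inst_pars bs' (Neg \<psi>) = Neg \<phi>" "inst_pars bs (Neg \<psi>) = Neg (inst_pars bs \<psi>)"
    using b(5) by (simp_all add: inst_pars_def)
  have "inst_pars bs \<psi> \<in> fmls_x L M (univ M)" using inst_pars_fmls_M[OF b(2)] b(3,4) sorts_eq by metis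
  then show "\<phi> \<in> p' \<or> Neg \<phi> \<in> p'"
    using transfer_iff[OF b(1-3), of \<psi>] transfer_iff[OF b(1-3), of "Neg \<psi>"] N b(4,5)
      types_complete[OF inv_types_types[OF p], of "inst_pars bs \<psi>"] by simp
next
  fix fs assume fs: "set fs \<subseteq> p'"
  have "p' \<subseteq> fmls_x L M' (univ M')"
    using inst_pars_fmls[of _ L M' "univ G" gs _ "univ M'"] subs(2) by (auto simp: transfer_type_def)
  with fs have "set fs \<subseteq> fmls_x L M' (univ M')" by blast
  then obtain bs' bs h where b: "bs' \<in> lists (univ M')" "bs \<in> lists (univ M)" "tup_equiv L M' (univ G) bs' bs"
    and h: "\<forall>\<phi>\<in>set fs. h \<phi> \<in> fmls L M' (univ G) (gs # map (sort_of M') bs') \<and> inst_pars bs' (h \<phi>) = \<phi>"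
    by (rule represent_fms)
  let ?\<psi> = "conj_list (map h fs)"
  have "set (map (\<lambda>\<phi>. inst_pars bs (h \<phi>)) fs) \<subseteq> p"
    using transfer_iff[OF b] h fs by fastforce
  then have "conj_list (map (\<lambda>\<phi>. inst_pars bs (h \<phi>)) fs) \<in> p"
    by (rule conj_list_in_type[OF inv_types_types[OF p]])
  then have "inst_pars bs ?\<psi> \<in> p" by (simp add: inst_conj_list comp_def)
  then obtain a where a: "a \<in> Dom M gs" "sat_tup M (a # bs) ?\<psi>"
    using types_finsat[OF inv_types_types[OF p], of "{inst_pars bs ?\<psi>}"] by (auto simp: sat_tup_inst_pars)
  have \<psi>: "?\<psi> \<in> fmls L M' (univ G) (gs # map (sort_of M') bs')"
    using h by (auto simp: conj_list_fmls)
  have "sat_tup M' (a # bs) ?\<psi>" "a \<in> Dom M' gs"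
    using sat_M[OF b(2) _ a(1), of ?\<psi>] a \<psi> sorts_eq[OF b(3)] elem_subD(5)[OF MM', of gs] by auto
  then have "sat_tup M' bs (Exi gs ?\<psi>)" by auto
  moreover have "sat_tup M' bs' (Exi gs ?\<psi>) = sat_tup M' bs (Exi gs ?\<psi>)"
    using b(3) \<psi> unfolding tup_equiv_def by (metis fmls_simps(5))
  ultimately obtain a' where "a' \<in> Dom M' gs" "sat_tup M' (a' # bs') ?\<psi>" by auto
  moreover have "map (inst_pars bs' \<circ> h) fs = fs" using h by (simp add: map_idI)
  then have "conj_list fs = inst_pars bs' ?\<psi>" by (simp add: inst_conj_list)
  ultimately show "\<exists>a\<in>Dom M' gs. sat_tup M' [a] (conj_list fs)" by (auto simp: sat_tup_inst_pars)
qed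

lemma transfer_inv_types: "p' \<in> inv_types L M' G"
  unfolding inv_types_def mem_Collect_eq
proof (intro conjI ballI impI transfer_types)
  fix bs' cs' \<phi>
  assume l: "bs' \<in> lists (univ M')" "cs' \<in> lists (univ M')" "tup_equiv L M' (univ G) bs' cs'"
    and \<phi>: "\<phi> \<in> fmls L M' (univ G) (gs # map (sort_of M') bs')"
  obtain bs where bs: "bs \<in> lists (univ M)" "tup_equiv L M' (univ G) bs' bs" using realize[OF l(1)] .
  show "inst_pars bs' \<phi> \<in> p' \<longleftrightarrow> inst_pars cs' \<phi> \<in> p'"
    using transfer_iff[OF l(1) bs \<phi>]
      transfer_iff[OF l(2) bs(1) tup_equiv_trans[OF tup_equiv_sym[OF l(3)] bs(2)], of \<phi>] \<phi> sorts_eq[OF l(3)]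
    by simp
qed

lemma transfer_extends: "p \<subseteq> p'"
proof
  fix \<phi> assume "\<phi> \<in> p"
  then have \<phi>: "\<phi> \<in> fmls_x L M (univ M)" using types_subset[OF inv_types_types[OF p]] by blast
  from finite_list[OF finite_params[of \<phi>]] obtain bs where bs: "set bs = set4_fm \<phi>" by auto
  have bsM: "bs \<in> lists (univ M)" using params_subset[OF \<phi>] bs by auto
  have "\<phi> \<in> fmls_x L M (univ G \<union> set bs)" by (rule fmls_mono[OF fmls_params[OF \<phi>]]) (use bs in auto)
  then obtain \<psi> where "\<psi> \<in> fmls L M (univ G) (gs # map (sort_of M) bs)" "inst_pars bs \<psi> = \<phi>"
    by (rule fmls_abstract1)
  with transfer_iff[OF _ bsM tup_equiv_refl, of \<psi>] \<open>\<phi> \<in> p\<close> bsM subs(3) show "\<phi> \<in> p'"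
    by (auto simp: fmls_G sort_M)
qed

text \<open>
  An invariant type \<open>q\<close> extending \<open>p\<close> contains \<open>\<psi>(x; b)\<close> together with \<open>p\<close> and hence \<open>\<psi>(x; b')\<close> by invariance;
  thus it contains \<open>p'\<close>, and complete types are maximal.
\<close>

lemma inv_ext_eq: "inv_ext L M' G p = p'"
  unfolding inv_ext_def
proof (rule the_equality)
  show "p' \<in> inv_types L M' G \<and> p \<subseteq> p'" using transfer_inv_types transfer_extends by blast
  fix q assume q: "q \<in> inv_types L M' G \<and> p \<subseteq> q"
  have "p' \<subseteq> q"
  proof
    fix \<phi> assume "\<phi> \<in> p'"
    then obtain bs' bs \<psi> where b: "\<phi> = inst_pars bs' \<psi>" "bs' \<in> lists (univ M')" "bs \<in> lists (univ M)"
      "tup_equiv L M' (univ G) bs' bs" "\<psi> \<in> fmls L M' (univ G) (gsort L # map (sort_of M') bs')"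
      "inst_pars bs \<psi> \<in> p"
      unfolding transfer_type_def by blast
    have "bs \<in> lists (univ M')" using b(3) subs(3) by auto
    from inv_typesD[OF conjunct1[OF q] b(2) this b(4,5)] b(1,6) q show "\<phi> \<in> q" by auto
  qed
  then show "q = p'" using types_eq[OF transfer_types inv_types_types[OF conjunct1[OF q]]] by simp
qed

lemma transfer_restrict: "\<phi> \<in> fmls_x L M (univ M) \<Longrightarrow> \<phi> \<in> p' \<longleftrightarrow> \<phi> \<in> p"
proof -
  assume \<phi>: "\<phi> \<in> fmls_x L M (univ M)"
  have "fmls_x L M (univ M) \<subseteq> fmls_x L M' (univ M')"
    using fmls_elem_sub[OF MM' order_refl] fmls_mono[OF _ subs(3)] by auto
  with \<phi> have "\<phi> \<in> fmls_x L M' (univ M')" by blast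
  then show "\<phi> \<in> p' \<longleftrightarrow> \<phi> \<in> p"
    using types_Neg_iff[OF transfer_types] types_complete[OF inv_types_types[OF p] \<phi>] transfer_extends by blast
qed

end

section \<open>Translates and products of types\<close>

lemma types_equiv:
  assumes p: "p \<in> types L M s A" and f: "\<phi> \<in> fmls L M A [s]" "\<psi> \<in> fmls L M A [s]"
    and e: "\<And>a. a \<in> Dom M s \<Longrightarrow> sat_tup M [a] \<phi> \<longleftrightarrow> sat_tup M [a] \<psi>"
  shows "\<phi> \<in> p \<longleftrightarrow> \<psi> \<in> p"
  using types_closed1[OF p _ f(2), of \<phi>] types_closed1[OF p _ f(1), of \<psi>] e by blast

abbreviation has_gmul where
  "has_gmul L \<equiv> fun_sig L (gmul L) = Some ([gsort L, gsort L], gsort L)"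

abbreviation gprod where
  "gprod L M a b \<equiv> fun_int M (gmul L) [a, b]"

lemma gprod_Dom:
  assumes "is_model L M" "has_gmul L" "a \<in> Dom M (gsort L)" "b \<in> Dom M (gsort L)"
  shows "gprod L M a b \<in> Dom M (gsort L)"
proof -
  have "\<forall>f ss s as. fun_sig L f = Some (ss, s) \<longrightarrow> list_all2 (\<lambda>a t. a \<in> Dom M t) as ss
        \<longrightarrow> fun_int M f as \<in> Dom M s"
    using assms(1) unfolding is_model_def by blast
  from this[rule_format, OF assms(2), of "[a, b]"] show ?thesis using assms(3,4) by simp
qed

lemma sat_translate:
  assumes "\<phi> \<in> fmls_x L M A"
  shows "sat_tup K [a] (translate L d \<phi>) \<longleftrightarrow> sat_tup K [gprod L K a d] \<phi>"
  unfolding translate_def sat_tup_def sat_subst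
  by (rule sat_cong[where L = L and M = M and A = A and \<Gamma> = "[gsort L]"])
    (use assms in \<open>simp_all add: fmls_def\<close>)

lemma translate_fmls:
  assumes "has_gmul L" "\<phi> \<in> fmls_x L M A" "A \<subseteq> B" "B \<subseteq> univ M" "d \<in> Dom M (gsort L)" "d \<in> B"
  shows "translate L d \<phi> \<in> fmls_x L M B"
  unfolding translate_def fmls_def mem_Collect_eq
proof (rule wf_subst)
  show "wf_fm L M A [gsort L] \<phi>" using assms(2) by (simp add: fmls_def)
  fix i assume i: "i < length [gsort L]"
  have "has_sort L M B [gsort L] (Var 0) (gsort L)" "has_sort L M B [gsort L] (Par d) (gsort L)"
    using has_sort_Var[of 0 "[gsort L]" L M B] has_sort_Par[of d B M L "[gsort L]"] assms(4-6)
    by (auto simp: Dom_def)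
  then show "has_sort L M B [gsort L] (App (gmul L) [Var 0, Par d]) ([gsort L] ! i)"
    using i by (simp add: has_sort_App[OF assms(1)])
qed (use assms in auto)

text \<open>The formula \<open>\<psi>(x \<cdot> y; z)\<close> in the variables \<open>x\<close>, \<open>y\<close>, \<open>z\<close>.\<close>

lemma ex_product_fm:
  fixes \<psi> :: "('s, 'f, 'r, 'a) fm"
  assumes sig: "has_gmul L" and \<psi>: "\<psi> \<in> fmls L M A (gsort L # \<Gamma>)" and A: "A \<subseteq> univ M"
  shows "\<exists>\<psi>' \<in> fmls L M A (gsort L # gsort L # \<Gamma>).
    \<forall>a d xs. sat_tup M (a # d # xs) \<psi>' = sat_tup M (gprod L M a d # xs) \<psi>"
proof (intro bexI allI)
  let ?\<sigma> = "case_nat (App (gmul L) [Var 0, Var 1]) (\<lambda>i. Var (Suc (Suc i))) :: nat \<Rightarrow> ('f, 'a) tm"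
  show "subst_fm ?\<sigma> \<psi> \<in> fmls L M A (gsort L # gsort L # \<Gamma>)"
    unfolding fmls_def mem_Collect_eq
  proof (rule wf_subst)
    show "wf_fm L M A (gsort L # \<Gamma>) \<psi>" using \<psi> by (simp add: fmls_def)
    have V: "has_sort L M A (gsort L # gsort L # \<Gamma>) (Var i) ((gsort L # gsort L # \<Gamma>) ! i)"
      if "i < Suc (Suc (length \<Gamma>))" for i
      using has_sort_Var[of i "gsort L # gsort L # \<Gamma>" L M A] that by simp
    fix i assume "i < length (gsort L # \<Gamma>)"
    then show "has_sort L M A (gsort L # gsort L # \<Gamma>) (?\<sigma> i) ((gsort L # \<Gamma>) ! i)"
      using has_sort_App[OF sig, of M A "gsort L # gsort L # \<Gamma>" "[Var 0, Var 1]"] V[of 0] V[of 1] V[of "Suc i"]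
      by (cases i) simp_all
  qed (use A in auto)
  fix a d and xs :: "'a list"
  have "(\<lambda>i. tm_val M ((!) (a # d # xs)) (?\<sigma> i)) = (!) (gprod L M a d # xs)"
  proof
    fix i show "tm_val M ((!) (a # d # xs)) (?\<sigma> i) = (gprod L M a d # xs) ! i"
      by (cases i) simp_all
  qed
  then show "sat_tup M (a # d # xs) (subst_fm ?\<sigma> \<psi>) = sat_tup M (gprod L M a d # xs) \<psi>"
    unfolding sat_tup_def sat_subst by simp
qed

text \<open>
  The translate of \<open>\<psi>(x; cs)\<close> by \<open>d\<close> is the instance at \<open>d # cs\<close> of \<open>\<psi>(x \<cdot> y; z)\<close>, so invariance of \<open>p\<close> applies
  to the tuple \<open>d # cs\<close>.
\<close>

lemma translate_invariant:
  assumes p: "p \<in> inv_types L M G" and sig: "has_gmul L" and G: "univ G \<subseteq> univ M"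
    and d: "d \<in> Dom M (gsort L)" "d' \<in> Dom M (gsort L)"
    and cs: "cs \<in> lists (univ M)" "cs' \<in> lists (univ M)"
    and e: "tup_equiv L M (univ G) (d # cs) (d' # cs')"
    and \<psi>: "\<psi> \<in> fmls L M (univ G) (gsort L # map (sort_of M) cs)"
  shows "translate L d (inst_pars cs \<psi>) \<in> p \<longleftrightarrow> translate L d' (inst_pars cs' \<psi>) \<in> p"
proof -
  have s: "map (sort_of M) cs = map (sort_of M) cs'" using e by (simp add: tup_equiv_def)
  obtain \<psi>' where \<psi>': "\<psi>' \<in> fmls L M (univ G) (gsort L # gsort L # map (sort_of M) cs)"
    "\<forall>a d xs. sat_tup M (a # d # xs) \<psi>' = sat_tup M (gprod L M a d # xs) \<psi>"
    using ex_product_fm[OF sig \<psi> G] by blast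
  have *: "translate L b (inst_pars xs \<psi>) \<in> p \<longleftrightarrow> inst_pars (b # xs) \<psi>' \<in> p"
    if b: "b \<in> Dom M (gsort L)" and xs: "xs \<in> lists (univ M)" "map (sort_of M) cs = map (sort_of M) xs" for b xs
  proof (rule types_equiv[OF inv_types_types[OF p]])
    have f: "inst_pars xs \<psi> \<in> fmls_x L M (univ M)"
      using \<psi> xs G by (intro inst_pars_fmls[of \<psi> L M "univ G"]) auto
    then show "translate L b (inst_pars xs \<psi>) \<in> fmls_x L M (univ M)"
      using b by (intro translate_fmls[OF sig]) (auto simp: Dom_def)
    show "inst_pars (b # xs) \<psi>' \<in> fmls_x L M (univ M)"
      using \<psi>' xs G b by (intro inst_pars_fmls[of \<psi>' L M "univ G"]) (auto simp: Dom_def)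
    show "sat_tup M [a] (translate L b (inst_pars xs \<psi>)) = sat_tup M [a] (inst_pars (b # xs) \<psi>')" for a
      using \<psi>'(2) by (simp add: sat_translate[OF f] sat_tup_inst_pars)
  qed
  have "inst_pars (d # cs) \<psi>' \<in> p \<longleftrightarrow> inst_pars (d' # cs') \<psi>' \<in> p"
    using \<psi>'(1) d cs by (intro inv_typesD[OF p _ _ e]) (auto simp: Dom_def)
  then show ?thesis using *[OF d(1) cs(1)] *[OF d(2) cs(2) s] by simp
qed

text \<open>
  Membership of \<open>\<phi>(x \<cdot> d)\<close> in an invariant type depends only on the type of \<open>d\<close> over \<open>G\<close> and the parameters
  of \<open>\<phi>\<close>. This makes the integrand of the convolution well defined and the product type independent of the
  chosen realizations.
\<close>

lemma translate_cong:
  assumes p: "p \<in> inv_types L M G" and sig: "has_gmul L" and M: "is_model L M"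
    and A: "univ G \<subseteq> A" "A \<subseteq> univ M"
    and d: "d \<in> Dom M (gsort L)" "d' \<in> Dom M (gsort L)" and e: "tup_equiv L M A [d] [d']"
    and \<phi>: "\<phi> \<in> fmls_x L M A"
  shows "translate L d \<phi> \<in> p \<longleftrightarrow> translate L d' \<phi> \<in> p"
proof -
  from finite_list[OF finite_params[of \<phi>]] obtain cs where cs: "set cs = set4_fm \<phi>" by auto
  have csA: "set cs \<subseteq> A" using params_subset[OF \<phi>] cs by auto
  have "\<phi> \<in> fmls_x L M (univ G \<union> set cs)" by (rule fmls_mono[OF fmls_params[OF \<phi>]]) (use cs in auto)
  then obtain \<psi> where \<psi>: "\<psi> \<in> fmls L M (univ G) (gsort L # map (sort_of M) cs)" "inst_pars cs \<psi> = \<phi>"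
    by (rule fmls_abstract1)
  have dU: "d \<in> univ M" "d' \<in> univ M" using d by (auto simp: Dom_def)
  have csU: "cs \<in> lists (univ M)" using csA A by auto
  have "tup_equiv L M (univ G) (d # cs) (d' # cs)"
    using tup_equiv_mono[OF tup_equiv_add_params[OF M A(2) e dU csA] A(1)] .
  from translate_invariant[OF p sig _ d csU csU this \<psi>(1)] \<psi>(2) A show ?thesis by auto
qed

locale invariant_product = invariant_type L T \<kappa> M G M' p
  for L :: "('s, 'f, 'r) lang" and T :: "('s, 'f, 'r, 'a) fm set" and \<kappa> :: "'k rel"
    and M G M' :: "('s, 'f, 'r, 'a) model" and p :: "('s, 'f, 'r, 'a) fm set" +
  fixes \<kappa>' :: "'l rel" and q :: "('s, 'f, 'r, 'a) fm set"
  assumes M': "monster L T \<kappa>' M'" and small_M: "small \<kappa>' (univ M)" and q: "q \<in> inv_types L M G"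
    and sig: "has_gmul L"
begin

lemma q': "q \<in> types_x L M' (univ M)"
  using inv_types_types[OF q] types_elem_sub[OF MM' order_refl] by simp

lemma fmls_M: "fmls L M (univ M) \<Gamma> = fmls L M' (univ M) \<Gamma>"
  by (rule fmls_elem_sub[OF MM' order_refl])

lemma realizations_q:
  obtains b where "b \<in> realizations M' gs q"
  using monsterD(5)[OF M' subs(3) small_M q'] by blast

text \<open>By \<open>prod_type_iff\<close> the quantifier over \<open>b\<close> may equally be read universally.\<close>

definition prod_type :: "('s, 'f, 'r, 'a) fm set" where
  "prod_type = {\<phi> \<in> fmls_x L M (univ M). \<exists>b \<in> realizations M' gs q. translate L b \<phi> \<in> p'}"

lemma prod_type_iff:
  assumes b: "b \<in> realizations M' gs q" and \<phi>: "\<phi> \<in> fmls_x L M (univ M)"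
  shows "\<phi> \<in> prod_type \<longleftrightarrow> translate L b \<phi> \<in> p'"
proof -
  have "translate L b' \<phi> \<in> p' \<longleftrightarrow> translate L b \<phi> \<in> p'" if b': "b' \<in> realizations M' gs q" for b'
    by (rule translate_cong[OF transfer_inv_types sig subs(5) subs(1) subs(3)])
      (use b b' \<phi> fmls_M realizations_equiv[OF q' b' b] in \<open>auto simp: realizations_def\<close>)
  then show ?thesis using b \<phi> unfolding prod_type_def by blast
qed

lemma tp_prod:
  assumes b: "b \<in> realizations M' gs q"
    and a: "a \<in> realizations M' gs (inv_ext L M' G p \<inter> fmls_x L M' (insert b (univ M)))"
  shows "tp L M' (gprod L M' a b) (univ M) = prod_type"
proof -
  have bD: "b \<in> Dom M' gs" "b \<in> univ M'" using b by (auto simp: realizations_def Dom_def)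
  have ins: "insert b (univ M) \<subseteq> univ M'" using bD subs(3) by auto
  have t: "p' \<inter> fmls_x L M' (insert b (univ M)) \<in> types_x L M' (insert b (univ M))"
    by (rule types_restrict[OF transfer_types ins])
  have "\<phi> \<in> tp L M' (gprod L M' a b) (univ M) \<longleftrightarrow> \<phi> \<in> prod_type"
    if \<phi>: "\<phi> \<in> fmls_x L M' (univ M)" for \<phi>
  proof -
    have tr: "translate L b \<phi> \<in> fmls_x L M' (insert b (univ M))"
      by (rule translate_fmls[OF sig \<phi> _ ins bD(1)]) auto
    have "\<phi> \<in> tp L M' (gprod L M' a b) (univ M) \<longleftrightarrow> sat_tup M' [a] (translate L b \<phi>)"
      using \<phi> by (simp add: tp_def sat_translate[OF \<phi>])
    also have "\<dots> \<longleftrightarrow> translate L b \<phi> \<in> p'"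
      using realizations_iff[OF t _ tr, of a] a tr by (simp add: inv_ext_eq)
    also have "\<dots> \<longleftrightarrow> \<phi> \<in> prod_type" using prod_type_iff[OF b] \<phi> fmls_M by simp
    finally show ?thesis .
  qed
  then show ?thesis unfolding tp_def prod_type_def fmls_M by blast
qed

lemma realizations_p':
  assumes b: "b \<in> realizations M' gs q"
  obtains a where "a \<in> realizations M' gs (inv_ext L M' G p \<inter> fmls_x L M' (insert b (univ M)))"
proof -
  have ins: "insert b (univ M) \<subseteq> univ M'" using b subs(3) by (auto simp: realizations_def Dom_def)
  have "small \<kappa>' (univ M \<union> {b})"
    by (rule small_Un_finite[OF monsterD(2)[OF M'] small_M monsterD(4)[OF M']]) simp
  then have "small \<kappa>' (insert b (univ M))" by simp
  from monsterD(5)[OF M' ins this types_restrict[OF transfer_types ins]] that show ?thesis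
    unfolding inv_ext_eq by blast
qed

lemma type_prod_eq: "type_prod L M M' G p q = prod_type"
  unfolding type_prod_def
proof (rule the_equality)
  obtain b where b: "b \<in> realizations M' gs q" by (rule realizations_q)
  obtain a where a: "a \<in> realizations M' gs (inv_ext L M' G p \<inter> fmls_x L M' (insert b (univ M)))"
    by (rule realizations_p'[OF b])
  show "\<exists>b\<in>realizations M' gs q. \<exists>a\<in>realizations M' gs (inv_ext L M' G p \<inter> fmls_x L M' (insert b (univ M))).
      prod_type = tp L M' (gprod L M' a b) (univ M)"
    using a b tp_prod[OF b a] by blast
qed (use tp_prod in blast)

lemma prod_type_types: "prod_type \<in> types_x L M (univ M)"
proof -
  obtain b where b: "b \<in> realizations M' gs q" by (rule realizations_q)
  obtain a where a: "a \<in> realizations M' gs (inv_ext L M' G p \<inter> fmls_x L M' (insert b (univ M)))"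
    by (rule realizations_p'[OF b])
  have "gprod L M' a b \<in> Dom M' gs"
    using a b by (intro gprod_Dom[OF subs(5) sig]) (auto simp: realizations_def)
  from tp_types[OF this, of "univ M"] show ?thesis
    using tp_prod[OF b a] types_elem_sub[OF MM' order_refl] by simp
qed

text \<open>
  A realization \<open>b\<close> of the \<open>G\<close>-invariant type \<open>q\<close> does not distinguish tuples of \<open>M\<close> with the same type over
  \<open>G\<close>; so \<open>b # bs\<close> and \<open>b # bs'\<close> have the same type over \<open>G\<close>, and invariance of \<open>p'\<close> applies to them.
\<close>

lemma prod_type_inv: "prod_type \<in> inv_types L M G"
  unfolding inv_types_def mem_Collect_eq
proof (intro conjI ballI impI prod_type_types)
  fix bs bs' \<phi>
  assume l: "bs \<in> lists (univ M)" "bs' \<in> lists (univ M)" and e: "tup_equiv L M (univ G) bs bs'"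
    and \<phi>: "\<phi> \<in> fmls L M (univ G) (gs # map (sort_of M) bs)"
  obtain b where b: "b \<in> realizations M' gs q" by (rule realizations_q)
  then have bD: "b \<in> Dom M' gs" "b \<in> univ M'" "sort_of M' b = gs" by (auto simp: realizations_def Dom_def)
  have s: "map (sort_of M) bs = map (sort_of M) bs'" using e by (simp add: tup_equiv_def)
  have l': "bs \<in> lists (univ M')" "bs' \<in> lists (univ M')" using l subs(3) by auto
  have "sat_tup M' (b # bs) \<psi> = sat_tup M' (b # bs') \<psi>"
    if \<psi>: "\<psi> \<in> fmls L M' (univ G) (gs # map (sort_of M') bs)" for \<psi>
  proof -
    have \<psi>M: "\<psi> \<in> fmls L M (univ G) (gs # map (sort_of M) bs)" using \<psi> by (simp only: fmls_G sort_M[OF l(1)])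
    have f: "inst_pars bs \<psi> \<in> fmls_x L M (univ M)" "inst_pars bs' \<psi> \<in> fmls_x L M (univ M)"
      using \<psi>M s l subs(1) by (auto intro!: inst_pars_fmls[of \<psi> L M "univ G"])
    have "inst_pars bs \<psi> \<in> q \<longleftrightarrow> inst_pars bs' \<psi> \<in> q" by (rule inv_typesD[OF q l e \<psi>M])
    then show ?thesis
      using realizations_iff[OF q' b] f fmls_M by (auto simp: sat_tup_inst_pars)
  qed
  then have e': "tup_equiv L M' (univ G) (b # bs) (b # bs')"
    using s bD sort_M l by (simp add: tup_equiv_def)
  have f: "inst_pars bs \<phi> \<in> fmls_x L M (univ M)" "inst_pars bs' \<phi> \<in> fmls_x L M (univ M)"
    using \<phi> s l subs(1) by (auto intro!: inst_pars_fmls[of \<phi> L M "univ G"])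
  have "\<phi> \<in> fmls L M' (univ G) (gs # map (sort_of M') bs)" using \<phi> by (simp only: fmls_G sort_M[OF l(1)])
  from translate_invariant[OF transfer_inv_types sig subs(2) bD(1) bD(1) l' e' this]
  show "inst_pars bs \<phi> \<in> prod_type \<longleftrightarrow> inst_pars bs' \<phi> \<in> prod_type"
    by (simp add: prod_type_iff[OF b f(1)] prod_type_iff[OF b f(2)])
qed

text \<open>
  The product type is computed inside \<open>M\<close>: a realization \<open>b\<close> of \<open>q\<close> in \<open>M'\<close> is replaced by a realization \<open>d\<close> of
  \<open>q|\<^sub>A\<close> in \<open>M\<close>. In the application, \<open>A\<close> is the union of \<open>G\<close> and the model at which the
  convolution is evaluated.
\<close>

lemma prod_type_realization:
  assumes A: "univ G \<subseteq> A" "A \<subseteq> univ M" and d: "d \<in> realizations M gs (q \<inter> fmls_x L M A)"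
    and \<phi>: "\<phi> \<in> fmls_x L M A"
  shows "\<phi> \<in> prod_type \<longleftrightarrow> translate L d \<phi> \<in> p"
proof -
  obtain b where b: "b \<in> realizations M' gs q" by (rule realizations_q)
  have fA: "fmls L M A \<Gamma> = fmls L M' A \<Gamma>" for \<Gamma> by (rule fmls_elem_sub[OF MM' A(2)])
  have \<phi>M: "\<phi> \<in> fmls_x L M (univ M)" by (rule fmls_mono[OF \<phi> A(2)])
  have dD: "d \<in> Dom M gs" "d \<in> Dom M' gs" "d \<in> univ M"
    using d elem_subD(5)[OF MM'] by (auto simp: realizations_def Dom_def)
  have A': "A \<subseteq> univ M'" using A subs(3) by auto
  have t: "q \<inter> fmls_x L M' A \<in> types_x L M' A" using types_restrict[OF q' A(2)] by simp
  have "b \<in> realizations M' gs (q \<inter> fmls_x L M' A)" using b by (auto simp: realizations_def)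
  moreover have "d \<in> realizations M' gs (q \<inter> fmls_x L M' A)"
  proof -
    have "sat_tup M' [d] \<psi>" if "\<psi> \<in> q" "\<psi> \<in> fmls_x L M' A" for \<psi>
    proof -
      have "sat_tup M [d] \<psi>" using d that fA by (auto simp: realizations_def)
      moreover have "sort_of M' d = gs" using dD(2) by (simp add: Dom_def)
      ultimately show ?thesis
        using sat_elem_sub[OF MM', of "[d]" \<psi>] fmls_mono[OF that(2) A(2)] dD by simp
    qed
    then show ?thesis using dD by (auto simp: realizations_def)
  qed
  ultimately have e: "tup_equiv L M' A [b] [d]" by (rule realizations_equiv[OF t])
  have "\<phi> \<in> prod_type \<longleftrightarrow> translate L b \<phi> \<in> p'" by (rule prod_type_iff[OF b \<phi>M])
  also have "\<dots> \<longleftrightarrow> translate L d \<phi> \<in> p'"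
    by (rule translate_cong[OF transfer_inv_types sig subs(5) A(1) A' _ dD(2) e])
      (use b \<phi> fA in \<open>auto simp: realizations_def\<close>)
  also have "\<dots> \<longleftrightarrow> translate L d \<phi> \<in> p"
    using dD by (intro transfer_restrict translate_fmls[OF sig \<phi>M]) auto
  finally show ?thesis .
qed

end

section \<open>Small elementary substructures\<close>

unbundle cardinal_syntax

lemma card_of_lists_le:
  fixes A :: "'b set"
  assumes B: "infinite B" and A: "|A| \<le>o |B|"
  shows "|lists A| \<le>o |B|"
proof -
  have "|{xs \<in> lists A. length xs = n}| \<le>o |B|" for n
  proof (induction n)
    case 0
    have "{xs \<in> lists A. length xs = 0} = {[]}" by auto
    moreover have "B \<noteq> {}" using B by auto
    then have "|{[] :: 'b list}| \<le>o |B|" by (rule card_of_singl_ordLeq)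
    ultimately show ?case by simp
  next
    case (Suc n)
    let ?C = "{xs \<in> lists A. length xs = n}"
    have "{xs \<in> lists A. length xs = Suc n} \<subseteq> (\<lambda>(x, xs). x # xs) ` (A \<times> ?C)"
      by (auto simp: length_Suc_conv image_iff)
    then have "|{xs \<in> lists A. length xs = Suc n}| \<le>o |(\<lambda>(x, xs). x # xs) ` (A \<times> ?C)|"
      by (rule card_of_mono1)
    also have "|(\<lambda>(x, xs). x # xs) ` (A \<times> ?C)| \<le>o |A \<times> ?C|" by (rule card_of_image)
    also have "|A \<times> ?C| \<le>o |B|"
      using card_of_Sigma_ordLeq_infinite[OF B A, of "\<lambda>_. ?C"] Suc.IH by blast
    finally show ?case .
  qed
  moreover have "lists A = (\<Union>n. {xs \<in> lists A. length xs = n})" by auto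
  moreover have "|UNIV :: nat set| \<le>o |B|" using B by (simp add: infinite_iff_card_of_nat)
  ultimately show ?thesis
    using card_of_UNION_ordLeq_infinite[OF B, of "UNIV :: nat set" "\<lambda>n. {xs \<in> lists A. length xs = n}"]
    by simp
qed

definition all_fmls :: "('s, 'f, 'r) lang \<Rightarrow> ('s, 'f, 'r, 'a) model \<Rightarrow> ('s, 'f, 'r, 'a) fm set" where
  "all_fmls L M = (\<Union>\<Gamma>. fmls L M {} \<Gamma>)"

text \<open>
  A Skolem function for an existential formula with arguments \<open>as\<close>. It has a value of the right sort even
  where there is no witness; applied to the formula saying that some element of a sort satisfies a
  tautology, it makes the hull meet that sort.
\<close>

definition skolem :: "('s, 'f, 'r, 'a) model \<Rightarrow> ('s, 'f, 'r, 'a) fm \<Rightarrow> 'a list \<Rightarrow> 'a" where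
  "skolem M \<phi> as = (case \<phi> of Exi s \<psi> \<Rightarrow> (SOME a. a \<in> Dom M s \<and>
      ((\<exists>b \<in> Dom M s. sat_tup M (b # as) \<psi>) \<longrightarrow> sat_tup M (a # as) \<psi>)) | _ \<Rightarrow> undefined)"

primrec skolem_hull_stage where
  "skolem_hull_stage L M X 0 = X"
| "skolem_hull_stage L M X (Suc n) = skolem_hull_stage L M X n \<union>
     (\<lambda>(\<phi>, as). skolem M \<phi> as) ` ({\<phi> \<in> all_fmls L M. \<exists>s \<psi>. \<phi> = Exi s \<psi>} \<times> lists (skolem_hull_stage L M X n))"

definition skolem_hull where "skolem_hull L M X = (\<Union>n. skolem_hull_stage L M X n)"

lemma skolem:
  assumes "is_model L M"
  shows "skolem M (Exi s \<psi>) as \<in> Dom M s"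
    "\<exists>b \<in> Dom M s. sat_tup M (b # as) \<psi> \<Longrightarrow> sat_tup M (skolem M (Exi s \<psi>) as # as) \<psi>"
proof -
  have "Dom M s \<noteq> {}" using assms unfolding is_model_def by blast
  then have "\<exists>a. a \<in> Dom M s \<and> ((\<exists>b \<in> Dom M s. sat_tup M (b # as) \<psi>) \<longrightarrow> sat_tup M (a # as) \<psi>)"
    by blast
  from someI_ex[OF this] show "skolem M (Exi s \<psi>) as \<in> Dom M s"
    "\<exists>b \<in> Dom M s. sat_tup M (b # as) \<psi> \<Longrightarrow> sat_tup M (skolem M (Exi s \<psi>) as # as) \<psi>"
    by (simp_all add: skolem_def)
qed

text \<open>A finite tuple of the hull already lives in one of the increasing stages.\<close>

lemma skolem_hull_skolem:
  assumes "Exi s \<psi> \<in> fmls L M {} \<Gamma>" "as \<in> lists (skolem_hull L M X)"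
  shows "skolem M (Exi s \<psi>) as \<in> skolem_hull L M X"
proof -
  have mono: "skolem_hull_stage L M X m \<subseteq> skolem_hull_stage L M X n" if "m \<le> n" for m n
    using that by (induction rule: dec_induct) auto
  have "\<exists>n. as \<in> lists (skolem_hull_stage L M X n)"
    using assms(2)
  proof (induction as rule: list.induct)
    case (Cons a as)
    then obtain n where n: "as \<in> lists (skolem_hull_stage L M X n)" by auto
    obtain m where m: "a \<in> skolem_hull_stage L M X m" using Cons.prems by (auto simp: skolem_hull_def)
    have "a # as \<in> lists (skolem_hull_stage L M X (max m n))"
      using n m mono[of m "max m n"] lists_mono[OF mono[of n "max m n"]] by auto
    then show ?case by blast
  qed auto
  then obtain n where n: "as \<in> lists (skolem_hull_stage L M X n)" by blast
  have "Exi s \<psi> \<in> all_fmls L M" using assms(1) unfolding all_fmls_def by blast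
  then have "skolem M (Exi s \<psi>) as \<in> skolem_hull_stage L M X (Suc n)"
    using n unfolding skolem_hull_stage.simps by blast
  then show ?thesis unfolding skolem_hull_def by blast
qed

lemma skolem_hull_subset:
  assumes "is_model L M" "X \<subseteq> univ M" shows "X \<subseteq> skolem_hull L M X" "skolem_hull L M X \<subseteq> univ M"
proof -
  show "X \<subseteq> skolem_hull L M X" unfolding skolem_hull_def using skolem_hull_stage.simps(1)[of L M X] by blast
  have "skolem_hull_stage L M X n \<subseteq> univ M" for n
  proof (induction n)
    case (Suc n)
    have "skolem M \<phi> as \<in> univ M" if "\<exists>s \<psi>. \<phi> = Exi s \<psi>" for \<phi> as
      using skolem(1)[OF assms(1)] that by (auto simp: Dom_def)
    then show ?case using Suc by auto
  qed (use assms in simp)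
  then show "skolem_hull L M X \<subseteq> univ M" unfolding skolem_hull_def by blast
qed

lemma skolem_hull_card:
  assumes B: "infinite B" and L: "|all_fmls L M| \<le>o |B|" and X: "|X| \<le>o |B|"
  shows "|skolem_hull L M X| \<le>o |B|"
proof -
  have "|skolem_hull_stage L M X n| \<le>o |B|" for n
  proof (induction n)
    case (Suc n)
    let ?S = "{\<phi> \<in> all_fmls L M. \<exists>s \<psi>. \<phi> = Exi s \<psi>} \<times> lists (skolem_hull_stage L M X n)"
    have "|{\<phi> \<in> all_fmls L M. \<exists>s \<psi>. \<phi> = Exi s \<psi>}| \<le>o |all_fmls L M|" by (rule card_of_mono1) auto
    then have "|{\<phi> \<in> all_fmls L M. \<exists>s \<psi>. \<phi> = Exi s \<psi>}| \<le>o |B|" using L by (rule ordLeq_transitive)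
    then have "|?S| \<le>o |B|"
      using card_of_Sigma_ordLeq_infinite[OF B, of _ "\<lambda>_. lists (skolem_hull_stage L M X n)"]
        card_of_lists_le[OF B Suc.IH] by blast
    then have "|(\<lambda>(\<phi>, as). skolem M \<phi> as) ` ?S| \<le>o |B|" using card_of_image ordLeq_transitive by blast
    with Suc.IH show ?case
      using card_of_Un_ordLeq_infinite_Field[of "|B|"] B by (simp add: Field_card_of card_of_card_order_on)
  qed (use X in simp)
  moreover have "|UNIV :: nat set| \<le>o |B|" using B by (simp add: infinite_iff_card_of_nat)
  ultimately show ?thesis unfolding skolem_hull_def by (intro card_of_UNION_ordLeq_infinite[OF B]) auto
qed

lemma tm_val_restrict: "tm_val (M\<lparr>univ := U\<rparr>) v t = tm_val M v t"
  by (induction t) (simp_all cong: map_cong)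

text \<open>
  The Tarski-Vaught test, carried out as an induction on formulas. Closure under the functions of the
  language is no separate condition: \<open>f(as)\<close> is the only witness of the formula \<open>\<exists>x. x = f(as)\<close>.
\<close>

lemma elem_sub_hull:
  assumes M: "is_model L M" and X: "X \<subseteq> univ M"
  shows "elem_sub L (M\<lparr>univ := skolem_hull L M X\<rparr>) M"
proof -
  let ?N = "M\<lparr>univ := skolem_hull L M X\<rparr>"
  note sub = skolem_hull_subset[OF M X]
  have Dom: "Dom ?N s = Dom M s \<inter> skolem_hull L M X" for s using sub(2) by (auto simp: Dom_def)
  have sat: "sat_tup ?N as \<phi> = sat_tup M as \<phi>"
    if "as \<in> lists (skolem_hull L M X)" "\<phi> \<in> fmls L M {} (map (sort_of M) as)" for as \<phi>
    using that
  proof (induction \<phi> arbitrary: as)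
    case (Exi s \<phi>)
    let ?a = "skolem M (Exi s \<phi>) as"
    have IH: "sat_tup ?N (a # as) \<phi> = sat_tup M (a # as) \<phi>" if "a \<in> Dom ?N s" for a
      using that Exi.prems Dom[of s] by (intro Exi.IH) (auto simp: Dom_def)
    have "?a \<in> Dom ?N s" unfolding Dom using skolem_hull_skolem[OF Exi.prems(2,1)] skolem(1)[OF M] by blast
    then show ?case
      using IH skolem(2)[OF M, of s as \<phi>] Dom[of s] unfolding sat_tup_simps by blast
  qed (simp_all add: sat_tup_def tm_val_restrict[abs_def] cong: map_cong)
  have "is_model L ?N"
    unfolding is_model_def
  proof (intro conjI allI impI)
    fix s
    have "skolem M (Exi s (Neg Fls)) [] \<in> Dom ?N s"
      unfolding Dom using skolem_hull_skolem[of s "Neg Fls" L M "[]" "[]" X] skolem(1)[OF M] by simp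
    then show "Dom ?N s \<noteq> {}" by blast
  next
    fix f ss s as
    assume f: "fun_sig L f = Some (ss, s)" and as: "list_all2 (\<lambda>a t. a \<in> Dom ?N t) as ss"
    have "list_all2 (\<lambda>a t. a \<in> Dom M t) as ss"
      using as by (rule list_all2_mono) (simp add: Dom)
    then have v: "fun_int M f as \<in> Dom M s" using M f unfolding is_model_def by blast
    let ?t = "App f (map (\<lambda>i. Var (Suc i)) [0..<length ss])"
    let ?\<phi> = "Eql (Var 0) ?t"
    have V: "has_sort L M {} (s # ss) (Var (Suc i)) (ss ! i)" if "i < length ss" for i
      using has_sort_Var[of "Suc i" "s # ss" L M "{}"] that by simp
    have "has_sort L M {} (s # ss) ?t s"
      by (rule has_sort_App[OF f]) (use V in \<open>simp add: list_all2_conv_all_nth\<close>)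
    then have wf: "?\<phi> \<in> fmls L M {} (s # ss)"
      using has_sort_Var[of 0 "s # ss" L M "{}"] by (auto simp: fmls_def)
    have "length as = length ss" using as by (rule list_all2_lengthD)
    then have "map (\<lambda>i. as ! i) [0..<length ss] = as" by (metis map_nth)
    then have *: "sat_tup M (a # as) ?\<phi> \<longleftrightarrow> a = fun_int M f as" for a
      by (simp add: sat_tup_def comp_def)
    have "skolem M (Exi s ?\<phi>) as = fun_int M f as"
      using skolem(2)[OF M, of s as ?\<phi>] * v by blast
    moreover have "as \<in> lists (skolem_hull L M X)"
      using as by (auto simp: Dom list_all2_conv_all_nth in_set_conv_nth)
    then have "skolem M (Exi s ?\<phi>) as \<in> skolem_hull L M X"
      using wf by (intro skolem_hull_skolem[where \<Gamma> = ss]) simp_all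
    ultimately show "fun_int ?N f as \<in> Dom ?N s" using v unfolding Dom by simp
  qed
  then show ?thesis unfolding elem_sub_def using M sub sat by simp
qed

text \<open>Downward Loewenheim-Skolem: the hull of \<open>X\<close> has at most as many elements as there are formulas
  without parameters and elements of \<open>X\<close> together.\<close>

lemma small_elem_sub_containing:
  assumes M: "monster L T \<kappa> M" and X: "X \<subseteq> univ M" "small \<kappa> X"
  obtains N where "elem_sub L N M" "X \<subseteq> univ N" "small \<kappa> (univ N)"
proof
  note mM = monsterD[OF M]
  let ?N = "M\<lparr>univ := skolem_hull L M X\<rparr>"
  show "elem_sub L ?N M" by (rule elem_sub_hull[OF mM(1) X(1)])
  show "X \<subseteq> univ ?N" using skolem_hull_subset[OF mM(1) X(1)] by simp
  let ?B = "all_fmls L M <+> X"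
  have B: "|?B| <o \<kappa>"
    using card_of_Plus_ordLess_infinite_Field[OF mM(4,2)] mM(3) X(2) by (simp add: small_def all_fmls_def)
  have "infinite (all_fmls L M)" using infinite_fmls by (simp add: all_fmls_def)
  then have "infinite ?B" by simp
  from skolem_hull_card[OF this card_of_Plus1 card_of_Plus2] B
  show "small \<kappa> (univ ?N)" unfolding small_def using ordLeq_ordLess_trans by auto
qed

section \<open>The space of types\<close>

lemma types_nonempty_member: "p \<in> types L M s A \<Longrightarrow> \<exists>\<phi>\<in>fmls L M A [s]. \<phi> \<in> p"
  using types_complete[of p L M s A Fls] by auto

lemma topspace_type_topology: "topspace (type_topology L M A) = types_x L M A"
  unfolding type_topology_def topology_generated_by_topspace
  using types_nonempty_member[of _ L M "gsort L" A] by blast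

lemma openin_basic: "\<phi> \<in> fmls_x L M A \<Longrightarrow> openin (type_topology L M A) {p \<in> types_x L M A. \<phi> \<in> p}"
  unfolding type_topology_def by (rule topology_generated_by_Basis) blast

text \<open>The sets \<open>[\<phi>]\<close> are introduced as a subbasis; they form a basis because types are closed under
  conjunction.\<close>

lemma type_topology_basis:
  assumes "openin (type_topology L M A) U" "q \<in> U"
  shows "\<exists>\<phi> \<in> q. \<phi> \<in> fmls_x L M A \<and> {p \<in> types_x L M A. \<phi> \<in> p} \<subseteq> U"
proof -
  have "generate_topology_on {{p \<in> types_x L M A. \<phi> \<in> p} |\<phi>. \<phi> \<in> fmls_x L M A} U"
    using assms(1) unfolding type_topology_def openin_topology_generated_by_iff .
  moreover have "q \<in> types_x L M A"
    using openin_subset[OF assms(1)] assms(2) topspace_type_topology by blast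
  ultimately show ?thesis using assms(2)
  proof (induction rule: generate_topology_on.induct)
    case (Int U V)
    then obtain \<phi> \<psi> where \<phi>: "\<phi> \<in> q" "\<phi> \<in> fmls_x L M A" "{p \<in> types_x L M A. \<phi> \<in> p} \<subseteq> U"
      and \<psi>: "\<psi> \<in> q" "\<psi> \<in> fmls_x L M A" "{p \<in> types_x L M A. \<psi> \<in> p} \<subseteq> V" by blast
    have "And \<phi> \<psi> \<in> q"
      by (rule types_closed[OF Int.prems(1), of "{\<phi>, \<psi>}"]) (use \<phi> \<psi> in auto)
    moreover have "{p \<in> types_x L M A. And \<phi> \<psi> \<in> p} \<subseteq> U \<inter> V"
    proof
      fix p assume "p \<in> {p \<in> types_x L M A. And \<phi> \<psi> \<in> p}"
      then have p: "p \<in> types_x L M A" "And \<phi> \<psi> \<in> p" by auto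
      have "\<phi> \<in> p" by (rule types_closed1[OF p \<phi>(2)]) simp
      moreover have "\<psi> \<in> p" by (rule types_closed1[OF p \<psi>(2)]) simp
      ultimately show "p \<in> U \<inter> V" using p \<phi>(3) \<psi>(3) by blast
    qed
    ultimately show ?case using \<phi>(2) \<psi>(2) by (intro bexI[of _ "And \<phi> \<psi>"]) simp_all
  next
    case (UN K)
    then obtain k where k: "k \<in> K" "q \<in> k" by blast
    from UN.IH[OF k(1) UN.prems(1) k(2)] k(1) show ?case by blast
  next
    case (Basis U)
    then show ?case by blast
  qed simp
qed

text \<open>Distinct types are separated by a formula: every other type contains the negation of some formula of
  \<open>q\<close>.\<close>

lemma closedin_singleton_type:
  assumes "q \<in> types_x L M A" shows "closedin (type_topology L M A) {q}"
  unfolding closedin_def topspace_type_topology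
proof (intro conjI)
  have "types_x L M A - {q} = (\<Union>\<phi>\<in>q. {p \<in> types_x L M A. Neg \<phi> \<in> p})"
  proof (intro equalityI subsetI)
    fix p assume p: "p \<in> types_x L M A - {q}"
    then obtain \<phi> where "\<phi> \<in> q" "\<phi> \<notin> p" using types_eq[OF assms, of p] by blast
    moreover have "Neg \<phi> \<in> p"
      using p calculation types_Neg_iff[of p L M "gsort L" A \<phi>] types_subset[OF assms] by blast
    ultimately show "p \<in> (\<Union>\<phi>\<in>q. {p \<in> types_x L M A. Neg \<phi> \<in> p})" using p by blast
  next
    fix p assume "p \<in> (\<Union>\<phi>\<in>q. {p \<in> types_x L M A. Neg \<phi> \<in> p})"
    then obtain \<phi> where "p \<in> types_x L M A" "\<phi> \<in> q" "Neg \<phi> \<in> p" by blast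
    moreover have "Neg \<phi> \<notin> q" using types_Neg_iff[OF assms, of \<phi>] calculation(2) types_subset[OF assms] by blast
    ultimately show "p \<in> types_x L M A - {q}" by blast
  qed
  moreover have "openin (type_topology L M A) (\<Union>\<phi>\<in>q. {p \<in> types_x L M A. Neg \<phi> \<in> p})"
    using types_subset[OF assms] openin_basic[of "Neg _" L M A] by (intro openin_Union) auto
  ultimately show "openin (type_topology L M A) (types_x L M A - {q})" by simp
qed (use assms in simp)

section \<open>Dirac measures\<close>

lemma dirac_apply: "\<phi> \<in> fmls_x L M (univ M) \<Longrightarrow> dirac L M p \<phi> = indicator p \<phi>"
  by (simp add: dirac_def)

lemma dirac_keisler:
  assumes p: "p \<in> types_x L M (univ M)"
  shows "dirac L M p \<in> keisler L M (univ M)"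
  unfolding keisler_def mem_Collect_eq
proof (intro conjI ballI impI)
  show "dirac L M p \<in> fmls_x L M (univ M) \<rightarrow>\<^sub>E {0..1}"
    by (auto simp: dirac_def indicator_def)
next
  fix \<phi> \<psi> assume f: "\<phi> \<in> fmls_x L M (univ M)" "\<psi> \<in> fmls_x L M (univ M)"
    and "\<forall>a\<in>Dom M (gsort L). sat_tup M [a] \<phi> = sat_tup M [a] \<psi>"
  then have "\<phi> \<in> p \<longleftrightarrow> \<psi> \<in> p" by (intro types_equiv[OF p]) auto
  then show "dirac L M p \<phi> = dirac L M p \<psi>" using f by (simp add: dirac_apply indicator_def)
next
  fix \<phi> assume f: "\<phi> \<in> fmls_x L M (univ M)" "\<forall>a\<in>Dom M (gsort L). sat_tup M [a] \<phi>"
  then have "\<phi> \<in> p" by (intro types_closed[OF p, of "{}"]) auto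
  then show "dirac L M p \<phi> = 1" using f by (simp add: dirac_apply)
next
  fix \<phi> \<psi> assume f: "\<phi> \<in> fmls_x L M (univ M)" "\<psi> \<in> fmls_x L M (univ M)"
    and d: "\<forall>a\<in>Dom M (gsort L). \<not> (sat_tup M [a] \<phi> \<and> sat_tup M [a] \<psi>)"
  have "Or \<phi> \<psi> \<in> p" if "\<phi> \<in> p" by (rule types_closed1[OF p that]) (use f in simp_all)
  moreover have "Or \<phi> \<psi> \<in> p" if "\<psi> \<in> p" by (rule types_closed1[OF p that]) (use f in simp_all)
  moreover have "\<psi> \<in> p" if "Or \<phi> \<psi> \<in> p" "Neg \<phi> \<in> p"
    by (rule types_closed[OF p, of "{Or \<phi> \<psi>, Neg \<phi>}"]) (use f that in auto)
  moreover have "Neg \<psi> \<in> p" if "\<phi> \<in> p"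
    by (rule types_closed1[OF p that]) (use f d in auto)
  ultimately have "Or \<phi> \<psi> \<in> p \<longleftrightarrow> \<phi> \<in> p \<or> \<psi> \<in> p" "\<not> (\<phi> \<in> p \<and> \<psi> \<in> p)"
    using types_Neg_iff[OF p f(1)] types_Neg_iff[OF p f(2)] by blast+
  then show "dirac L M p (Or \<phi> \<psi>) = dirac L M p \<phi> + dirac L M p \<psi>"
    using f by (auto simp: dirac_apply indicator_def)
qed

lemma dirac_inv_keisler:
  assumes p: "p \<in> inv_types L M G" and G: "univ G \<subseteq> univ M"
  shows "dirac L M p \<in> inv_keisler L M G"
  unfolding inv_keisler_def mem_Collect_eq
proof (intro conjI ballI impI)
  show "dirac L M p \<in> keisler L M (univ M)" by (rule dirac_keisler[OF inv_types_types[OF p]])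
  fix bs bs' \<phi>
  assume l: "bs \<in> lists (univ M)" "bs' \<in> lists (univ M)" and e: "tup_equiv L M (univ G) bs bs'"
    and \<phi>: "\<phi> \<in> fmls L M (univ G) (gsort L # map (sort_of M) bs)"
  have s: "map (sort_of M) bs = map (sort_of M) bs'" using e by (simp add: tup_equiv_def)
  have f: "inst_pars bs \<phi> \<in> fmls_x L M (univ M)" "inst_pars bs' \<phi> \<in> fmls_x L M (univ M)"
    using \<phi> s l G by (auto intro!: inst_pars_fmls[of \<phi> L M "univ G"])
  show "dirac L M p (inst_pars bs \<phi>) = dirac L M p (inst_pars bs' \<phi>)"
    using inv_typesD[OF p l e \<phi>] by (simp add: dirac_apply f indicator_def)
qed

text \<open>
  Each coordinate \<open>p \<mapsto> \<delta>\<^sub>p(\<phi>)\<close> is locally constant since \<open>[\<phi>]\<close> and its complement \<open>[\<not>\<phi>]\<close> are open. The inverse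
  collects the formulas of measure above \<open>1/2\<close>; the threshold could be any number strictly between \<open>0\<close> and
  \<open>1\<close>, and it turns membership of \<open>\<phi>\<close> into an open condition on the measure.
\<close>

lemma dirac_embedding:
  assumes G: "univ G \<subseteq> univ M"
  shows "embedding_map
           (subtopology (type_topology L M (univ M)) (inv_types L M G))
           (subtopology (keisler_topology L M (univ M)) (inv_keisler L M G))
           (dirac L M)"
proof -
  let ?A = "univ M"
  let ?X = "subtopology (type_topology L M ?A) (inv_types L M G)"
  let ?P = "product_topology (\<lambda>_. top_of_set {0..1::real}) (fmls_x L M ?A)"
  let ?Y = "subtopology (keisler_topology L M ?A) (inv_keisler L M G)"
  let ?Z = "subtopology ?Y (dirac L M ` topspace ?X)"
  let ?g = "\<lambda>\<mu>. {\<phi> \<in> fmls_x L M ?A. \<mu> \<phi> > (1/2 :: real)}"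
  have tX: "topspace ?X = inv_types L M G"
    using inv_types_types[of _ L M G] by (auto simp: topspace_type_topology)
  have g: "?g (dirac L M p) = p" if "p \<in> inv_types L M G" for p
  proof -
    have "(1/2 < (indicator p \<phi> :: real)) = (\<phi> \<in> p)" for \<phi> by (simp add: indicator_def)
    then show ?thesis using types_subset[OF inv_types_types[OF that]] by (auto simp: dirac_apply)
  qed
  have coord: "continuous_map ?X (top_of_set {0..1}) (\<lambda>p. dirac L M p \<phi>)" if \<phi>: "\<phi> \<in> fmls_x L M ?A" for \<phi>
    unfolding continuous_map_in_subtopology
  proof (intro conjI)
    show "continuous_map ?X euclideanreal (\<lambda>p. dirac L M p \<phi>)"
      unfolding continuous_map_def
    proof (intro conjI allI impI)
      fix U :: "real set"
      let ?T = "(if 1 \<in> U then {p \<in> types_x L M ?A. \<phi> \<in> p} else {}) \<union>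
                (if 0 \<in> U then {p \<in> types_x L M ?A. Neg \<phi> \<in> p} else {})"
      have "{p \<in> topspace ?X. dirac L M p \<phi> \<in> U} = ?T \<inter> inv_types L M G"
        unfolding tX using inv_types_types[of _ L M G] types_Neg_iff[OF _ \<phi>]
        by (auto simp: dirac_apply[OF \<phi>] indicator_def)
      moreover have "openin (type_topology L M ?A) ?T"
        using openin_basic[of \<phi> L M ?A] openin_basic[of "Neg \<phi>" L M ?A] \<phi> by auto
      ultimately show "openin ?X {p \<in> topspace ?X. dirac L M p \<phi> \<in> U}"
        unfolding openin_subtopology by blast
    qed simp
    show "(\<lambda>p. dirac L M p \<phi>) \<in> topspace ?X \<rightarrow> {0..1}"
      by (auto simp: dirac_apply[OF \<phi>] indicator_def)
  qed
  have cf: "continuous_map ?X ?Z (dirac L M)"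
    unfolding continuous_map_in_subtopology keisler_topology_def
  proof (intro conjI)
    show "continuous_map ?X ?P (dirac L M)"
      unfolding continuous_map_componentwise using coord by (auto simp: dirac_def)
  qed (use dirac_inv_keisler[OF _ G] dirac_keisler[OF inv_types_types] tX in auto)
  have proj: "continuous_map ?Z euclideanreal (\<lambda>\<mu>. \<mu> \<phi>)" if "\<phi> \<in> fmls_x L M ?A" for \<phi>
  proof -
    have "continuous_map ?P (top_of_set {0..1}) (\<lambda>\<mu>. \<mu> \<phi>)"
      by (rule continuous_map_product_projection[OF that])
    then have "continuous_map ?P euclideanreal (\<lambda>\<mu>. \<mu> \<phi>)" by (rule continuous_map_into_fulltopology)
    then show ?thesis unfolding keisler_topology_def by (intro continuous_map_from_subtopology)
  qed
  have tZ: "topspace ?Z = dirac L M ` inv_types L M G"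
  proof -
    have "dirac L M ` topspace ?X \<subseteq> topspace ?Z" using cf by (auto simp: continuous_map_def)
    then show ?thesis unfolding tX by auto
  qed
  have cg: "continuous_map ?Z ?X ?g"
    unfolding continuous_map_in_subtopology
  proof (intro conjI)
    have "continuous_map ?Z (topology_generated_by {{p \<in> types_x L M ?A. \<phi> \<in> p} |\<phi>. \<phi> \<in> fmls_x L M ?A}) ?g"
    proof (rule continuous_on_generated_topo)
      fix U assume "U \<in> {{p \<in> types_x L M ?A. \<phi> \<in> p} |\<phi>. \<phi> \<in> fmls_x L M ?A}"
      then obtain \<phi> where \<phi>: "\<phi> \<in> fmls_x L M ?A" "U = {p \<in> types_x L M ?A. \<phi> \<in> p}" by blast
      have "?g -` U \<inter> topspace ?Z = {\<mu> \<in> topspace ?Z. \<mu> \<phi> \<in> {1/2<..}}"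
        unfolding tZ using g inv_types_types[of _ L M G] \<phi> by auto
      also have "openin ?Z \<dots>"
        by (rule openin_continuous_map_preimage[OF proj[OF \<phi>(1)]]) simp
      finally show "openin ?Z (?g -` U \<inter> topspace ?Z)" .
    next
      show "?g ` topspace ?Z \<subseteq> \<Union> {{p \<in> types_x L M ?A. \<phi> \<in> p} |\<phi>. \<phi> \<in> fmls_x L M ?A}"
      proof
        fix p assume "p \<in> ?g ` topspace ?Z"
        then have "p \<in> topspace (type_topology L M ?A)"
          unfolding tZ topspace_type_topology using g inv_types_types[of _ L M G] by auto
        then show "p \<in> \<Union> {{p \<in> types_x L M ?A. \<phi> \<in> p} |\<phi>. \<phi> \<in> fmls_x L M ?A}"
          by (simp only: type_topology_def topology_generated_by_topspace)
      qed
    qed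
    then show "continuous_map ?Z (type_topology L M ?A) ?g" by (simp only: type_topology_def)
    show "?g \<in> topspace ?Z \<rightarrow> inv_types L M G" unfolding tZ using g by auto
  qed
  have "homeomorphic_maps ?X ?Z (dirac L M) ?g"
    unfolding homeomorphic_maps_def using cf cg g tX tZ by auto
  then show ?thesis unfolding embedding_map_def homeomorphic_map_maps by blast
qed

section \<open>Point masses as regular Borel measures\<close>

lemma space_borel_of: "space (borel_of X) = topspace X"
  unfolding borel_of_def by (rule space_measure_of) (auto dest: openin_subset)

lemma sets_borel_of: "sets (borel_of X) = sigma_sets (topspace X) {U. openin X U}"
  unfolding borel_of_def by (rule sets_measure_of) (auto dest: openin_subset)

lemma openin_sets: "openin X U \<Longrightarrow> U \<in> sets (borel_of X)"
  by (auto simp: sets_borel_of)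

lemma closedin_sets: "closedin X C \<Longrightarrow> C \<in> sets (borel_of X)"
proof -
  assume C: "closedin X C"
  have "topspace X - (topspace X - C) \<in> sets (borel_of X)"
    using C openin_sets[of X "topspace X - C"] sets.compl_sets[of "topspace X - C" "borel_of X"]
    by (simp add: closedin_def space_borel_of)
  then show ?thesis using closedin_subset[OF C] by (simp add: double_diff)
qed

text \<open>Outer regularity needs the complement of the point to be open, inner regularity the point to be
  compact and measurable.\<close>

lemma return_regular:
  assumes q: "closedin X {q}"
  shows "regular_borel_prob X (return (borel_of X) q)"
proof -
  let ?m = "return (borel_of X) q"
  have qX: "q \<in> topspace X" using closedin_subset[OF q] by simp
  interpret prob_space ?m by (rule prob_space_return) (simp add: qX space_borel_of)
  have em: "emeasure ?m B = indicator B q" if "B \<in> sets (borel_of X)" for B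
    using that by simp
  show ?thesis unfolding regular_borel_prob_def
  proof (intro conjI ballI)
    show "prob_space ?m" by (rule prob_space_axioms)
    show "space ?m = topspace X" by (simp add: space_borel_of)
    fix B assume "B \<in> sets ?m"
    then have B: "B \<in> sets (borel_of X)" by simp
    then have BX: "B \<subseteq> topspace X" using sets.sets_into_space space_borel_of by metis
    show "emeasure ?m B = (INF U \<in> {U. openin X U \<and> B \<subseteq> U}. emeasure ?m U)"
    proof (rule antisym)
      show "emeasure ?m B \<le> (INF U \<in> {U. openin X U \<and> B \<subseteq> U}. emeasure ?m U)"
        by (rule INF_greatest) (auto intro!: emeasure_mono openin_sets)
      let ?U = "if q \<in> B then topspace X else topspace X - {q}"
      have U: "openin X ?U" "B \<subseteq> ?U" using q BX by (auto simp: closedin_def)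
      have "(INF U \<in> {U. openin X U \<and> B \<subseteq> U}. emeasure ?m U) \<le> emeasure ?m ?U"
        by (rule INF_lower) (use U in auto)
      also have "\<dots> = emeasure ?m B" using em[OF openin_sets[OF U(1)]] em[OF B] qX by auto
      finally show "(INF U \<in> {U. openin X U \<and> B \<subseteq> U}. emeasure ?m U) \<le> emeasure ?m B" .
    qed
    show "emeasure ?m B = (SUP K \<in> {K. compactin X K \<and> K \<subseteq> B}. emeasure ?m K)"
    proof (rule antisym)
      show "(SUP K \<in> {K. compactin X K \<and> K \<subseteq> B}. emeasure ?m K) \<le> emeasure ?m B"
        by (rule SUP_least, rule emeasure_mono) (use B in auto)
      let ?K = "if q \<in> B then {q} else {}"
      have K: "compactin X ?K" "?K \<subseteq> B" "?K \<in> sets (borel_of X)"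
        using qX closedin_sets[OF q] by auto
      have "emeasure ?m B = emeasure ?m ?K" using em[OF K(3)] em[OF B] by auto
      also have "\<dots> \<le> (SUP K \<in> {K. compactin X K \<and> K \<subseteq> B}. emeasure ?m K)"
        by (rule SUP_upper) (use K in auto)
      finally show "emeasure ?m B \<le> (SUP K \<in> {K. compactin X K \<and> K \<subseteq> B}. emeasure ?m K)" .
    qed
  qed simp
qed

text \<open>Outer regularity at the closed set \<open>{q}\<close> yields that the point itself has mass \<open>1\<close>.\<close>

lemma regular_point_mass:
  assumes q: "closedin X {q}" and m: "regular_borel_prob X m"
    and U: "\<And>U. openin X U \<Longrightarrow> q \<in> U \<Longrightarrow> emeasure m U = 1"
  shows "m = return (borel_of X) q"
proof (rule measure_eqI)
  interpret prob_space m using m by (simp add: regular_borel_prob_def)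
  have s: "sets m = sets (borel_of X)" "space m = topspace X" using m by (auto simp: regular_borel_prob_def)
  then show "sets m = sets (return (borel_of X) q)" by simp
  have qs: "{q} \<in> sets m" using closedin_sets[OF q] s by simp
  have qX: "q \<in> topspace X" using closedin_subset[OF q] by simp
  have "emeasure m {q} = (INF U \<in> {U. openin X U \<and> {q} \<subseteq> U}. emeasure m U)"
    using m qs by (auto simp: regular_borel_prob_def)
  also have "\<dots> = (INF U \<in> {U. openin X U \<and> {q} \<subseteq> U}. 1)" using U by (intro INF_cong) auto
  also have "\<dots> = 1" using qX by (intro cINF_const) auto
  finally have e1: "emeasure m {q} = 1" .
  fix B assume B: "B \<in> sets m"
  show "emeasure m B = emeasure (return (borel_of X) q) B"
  proof (cases "q \<in> B")
    case True
    have "emeasure m {q} \<le> emeasure m B" by (rule emeasure_mono) (use True B in auto)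
    then have "emeasure m B = 1" unfolding e1 by (rule order_antisym[OF emeasure_le_1])
    then show ?thesis using True B s by simp
  next
    case False
    have "emeasure m B \<le> emeasure m (space m - {q})"
      by (rule emeasure_mono) (use False B qs sets.sets_into_space[OF B] in auto)
    also have "\<dots> = 0"
      using prob_compl[OF qs] e1 by (simp add: emeasure_eq_measure)
    finally show ?thesis using False B s by simp
  qed
qed

text \<open>
  The measure is determined on basic open sets by definition, so every open neighbourhood of \<open>q\<close> has
  mass \<open>1\<close>, and regularity concentrates the mass on \<open>q\<close>.
\<close>

lemma borel_ext_dirac:
  assumes q: "q \<in> types_x L M A" and \<nu>: "\<And>\<phi>. \<phi> \<in> fmls_x L M A \<Longrightarrow> \<nu> \<phi> = indicator q \<phi>"
  shows "borel_ext L M A \<nu> = return (borel_of (type_topology L M A)) q"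
  unfolding borel_ext_def
proof (rule the_equality)
  let ?X = "type_topology L M A"
  note cl = closedin_singleton_type[OF q]
  show "regular_borel_prob ?X (return (borel_of ?X) q) \<and>
    (\<forall>\<phi>\<in>fmls_x L M A. measure (return (borel_of ?X) q) {p \<in> types_x L M A. \<phi> \<in> p} = \<nu> \<phi>)"
  proof (intro conjI ballI return_regular[OF cl])
    fix \<phi> assume \<phi>: "\<phi> \<in> fmls_x L M A"
    show "measure (return (borel_of ?X) q) {p \<in> types_x L M A. \<phi> \<in> p} = \<nu> \<phi>"
      using \<nu>[OF \<phi>] q by (simp add: measure_return openin_sets[OF openin_basic[OF \<phi>]] indicator_def)
  qed
  fix m assume m: "regular_borel_prob ?X m \<and>
    (\<forall>\<phi>\<in>fmls_x L M A. measure m {p \<in> types_x L M A. \<phi> \<in> p} = \<nu> \<phi>)"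
  then interpret prob_space m by (simp add: regular_borel_prob_def)
  have s: "sets m = sets (borel_of ?X)" using m by (simp add: regular_borel_prob_def)
  show "m = return (borel_of ?X) q"
  proof (rule regular_point_mass[OF cl conjunct1[OF m]])
    fix U assume U: "openin ?X U" "q \<in> U"
    from type_topology_basis[OF this] obtain \<phi> where \<phi>: "\<phi> \<in> q" "\<phi> \<in> fmls_x L M A"
      "{p \<in> types_x L M A. \<phi> \<in> p} \<subseteq> U" by blast
    have "emeasure m {p \<in> types_x L M A. \<phi> \<in> p} = 1"
      using m \<nu>[OF \<phi>(2)] \<phi> by (simp add: emeasure_eq_measure)
    moreover have "emeasure m {p \<in> types_x L M A. \<phi> \<in> p} \<le> emeasure m U"
      by (rule emeasure_mono[OF \<phi>(3)]) (use openin_sets[OF U(1)] s in simp)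
    ultimately have "1 \<le> emeasure m U" by simp
    then show "emeasure m U = 1" by (rule order_antisym[OF emeasure_le_1])
  qed
qed

lemma integral_point_mass:
  fixes f :: "'b \<Rightarrow> real"
  assumes q: "closedin X {q}"
  shows "integral\<^sup>L (restrict_space (return (borel_of X) q) {q}) f = f q"
proof -
  have qX: "q \<in> space (borel_of X)" using closedin_subset[OF q] by (simp add: space_borel_of)
  have qs: "{q} \<in> sets (borel_of X)" by (rule closedin_sets[OF q])
  have "integral\<^sup>L (restrict_space (return (borel_of X) q) {q}) f
    = (\<integral>x. indicator {q} x *\<^sub>R f x \<partial>return (borel_of X) q)"
    by (rule integral_restrict_space) (use qs in simp)
  also have "\<dots> = (\<integral>x. indicator {q} x *\<^sub>R f q \<partial>return (borel_of X) q)"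
    by (rule Bochner_Integration.integral_cong) (auto simp: indicator_def)
  also have "\<dots> = f q"
    using qX qs by (subst integral_return) auto
  finally show ?thesis .
qed

lemma borel_measurable_singleton_space:
  assumes "topspace Y \<subseteq> {r}"
  shows "f \<in> borel_measurable (borel_of Y)"
proof (rule measurableI)
  fix B :: "'b set"
  have "f -` B \<inter> space (borel_of Y) = {} \<or> f -` B \<inter> space (borel_of Y) = space (borel_of Y)"
    using assms by (auto simp: space_borel_of)
  then show "f -` B \<inter> space (borel_of Y) \<in> sets (borel_of Y)" by (metis sets.empty_sets sets.top)
qed simp

section \<open>Convolution of Dirac measures\<close>

lemma support_dirac:
  assumes q: "q \<in> types_x L M (univ M)" and A: "A \<subseteq> univ M"
  shows "support L M A (restrict (dirac L M q) (fmls_x L M A)) = {q \<inter> fmls_x L M A}"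
proof -
  have qA: "q \<inter> fmls_x L M A \<in> types_x L M A" by (rule types_restrict[OF q A])
  have d: "restrict (dirac L M q) (fmls_x L M A) \<phi> = indicator q \<phi>" if "\<phi> \<in> fmls_x L M A" for \<phi>
    using that dirac_apply[OF fmls_mono[OF that A]] by simp
  have "p = q \<inter> fmls_x L M A"
    if p: "p \<in> types_x L M A" "\<forall>\<phi>\<in>p. restrict (dirac L M q) (fmls_x L M A) \<phi> > 0" for p
  proof (rule types_eq[OF p(1) qA], rule subsetI)
    fix \<phi> assume "\<phi> \<in> p"
    moreover then have "\<phi> \<in> fmls_x L M A" using types_subset[OF p(1)] by blast
    ultimately show "\<phi> \<in> q \<inter> fmls_x L M A" using p(2) d[of \<phi>] by (auto simp: indicator_def split: if_splits)
  qed
  moreover have "\<forall>\<phi>\<in>q \<inter> fmls_x L M A. restrict (dirac L M q) (fmls_x L M A) \<phi> > 0" using d by simp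
  ultimately show ?thesis unfolding support_def using qA by blast
qed

lemma conv_model_dirac:
  assumes p: "p \<in> inv_types L M G" and q: "q \<in> types_x L M (univ M)" and sig: "has_gmul L"
    and N: "elem_sub L N M" "small \<kappa> (univ N)" "univ G \<subseteq> univ N" and \<phi>: "\<phi> \<in> fmls_x L M (univ N)"
  shows "conv_model L \<kappa> M (dirac L M p) (dirac L M q) \<phi> N"
proof -
  note NM = elem_subD(3)[OF N(1)]
  let ?q = "q \<inter> fmls_x L M (univ N)"
  have "dirac L M p (translate L d \<phi>) = dirac L M p (translate L d' \<phi>)"
    if d: "d \<in> realizations M (gsort L) ?q" "d' \<in> realizations M (gsort L) ?q" for d d'
  proof -
    have D: "d \<in> Dom M (gsort L)" "d' \<in> Dom M (gsort L)" using d by (auto simp: realizations_def)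
    have "translate L d \<phi> \<in> p \<longleftrightarrow> translate L d' \<phi> \<in> p"
      by (rule translate_cong[OF p sig elem_subD(2)[OF N(1)] N(3) NM D
            realizations_equiv[OF types_restrict[OF q NM] d] \<phi>])
    moreover have "translate L d \<phi> \<in> fmls_x L M (univ M)" "translate L d' \<phi> \<in> fmls_x L M (univ M)"
      using D by (auto intro!: translate_fmls[OF sig \<phi> NM] simp: Dom_def)
    ultimately show ?thesis by (simp add: dirac_apply indicator_def)
  qed
  moreover have "conv_fun L M (dirac L M p) \<phi> \<in>
      borel_measurable (borel_of (subtopology (type_topology L M (univ N)) {?q}))"
    by (rule borel_measurable_singleton_space[of _ ?q]) auto
  ultimately show ?thesis
    unfolding conv_model_def Let_def support_dirac[OF q NM] using N \<phi> by blast
qed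

lemma dirac_star_borel:
  assumes M: "monster L T \<kappa> M" and G: "elem_sub L G M" "small \<kappa> (univ G)" and sig: "has_gmul L"
    and p: "p \<in> inv_types L M G" and q: "q \<in> types_x L M (univ M)"
  shows "star_borel L \<kappa> M (dirac L M p) (dirac L M q)"
  unfolding star_borel_def
proof
  fix \<phi> assume \<phi>: "\<phi> \<in> fmls_x L M (univ M)"
  have "univ G \<union> set4_fm \<phi> \<subseteq> univ M" using params_subset[OF \<phi>] elem_subD(3)[OF G(1)] by auto
  moreover have "small \<kappa> (univ G \<union> set4_fm \<phi>)"
    by (rule small_Un_finite[OF monsterD(2)[OF M] G(2) monsterD(4)[OF M] finite_params])
  ultimately obtain N where N: "elem_sub L N M" "univ G \<union> set4_fm \<phi> \<subseteq> univ N" "small \<kappa> (univ N)"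
    by (rule small_elem_sub_containing[OF M])
  have "\<phi> \<in> fmls_x L M (univ N)" by (rule fmls_mono[OF fmls_params[OF \<phi>]]) (use N in auto)
  then have "conv_model L \<kappa> M (dirac L M p) (dirac L M q) \<phi> N"
    using N by (intro conv_model_dirac[OF p q sig]) auto
  then show "\<exists>N. conv_model L \<kappa> M (dirac L M p) (dirac L M q) \<phi> N" by blast
qed

context invariant_product begin

text \<open>
  Here \<open>N\<close> is an arbitrary admissible model, possibly not containing \<open>G\<close>. Since admissibility includes that
  the value is the same at all realizations of \<open>q|\<^sub>N\<close>, it may be computed at a realization of \<open>q|\<^sub>A\<close>
  with \<open>A = N \<union> G\<close>.
\<close>

lemma conv_fun_dirac:
  assumes N: "conv_model L \<kappa> M (dirac L M p) (dirac L M q) \<phi> N"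
  shows "conv_fun L M (dirac L M p) \<phi> (q \<inter> fmls_x L M (univ N)) = indicator prod_type \<phi>"
proof -
  have NM: "univ N \<subseteq> univ M" and sN: "small \<kappa> (univ N)" and \<phi>: "\<phi> \<in> fmls_x L M (univ N)"
    using N elem_subD(3)[of L N M] unfolding conv_model_def by auto
  note q0 = inv_types_types[OF q]
  let ?q = "q \<inter> fmls_x L M (univ N)"
  have wd: "dirac L M p (translate L d \<phi>) = dirac L M p (translate L d' \<phi>)"
    if "d \<in> realizations M gs ?q" "d' \<in> realizations M gs ?q" for d d'
    using N that unfolding conv_model_def Let_def support_dirac[OF q0 NM] by blast
  let ?A = "univ N \<union> univ G"
  have A: "univ G \<subseteq> ?A" "?A \<subseteq> univ M" using NM subs by auto
  have "small \<kappa> ?A"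
    using card_of_Un_ordLess_infinite_Field[OF monsterD(4)[OF M] monsterD(2)[OF M]] sN G
    by (simp add: small_def)
  then obtain d where d: "d \<in> realizations M gs (q \<inter> fmls_x L M ?A)"
    using monsterD(5)[OF M A(2) _ types_restrict[OF q0 A(2)]] by blast
  have \<phi>A: "\<phi> \<in> fmls_x L M ?A" by (rule fmls_mono[OF \<phi>]) auto
  have dN: "d \<in> realizations M gs ?q"
    using d fmls_mono[of _ L M "univ N" _ ?A] by (auto simp: realizations_def)
  have "translate L d \<phi> \<in> fmls_x L M (univ M)"
    using d by (intro translate_fmls[OF sig \<phi> NM]) (auto simp: realizations_def Dom_def)
  then have val: "dirac L M p (translate L d \<phi>) = indicator prod_type \<phi>"
    using prod_type_realization[OF A d \<phi>A] by (simp add: dirac_apply indicator_def)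
  show ?thesis
    unfolding conv_fun_def
  proof (rule the_equality)
    show "\<exists>d\<in>realizations M gs ?q. indicator prod_type \<phi> = dirac L M p (translate L d \<phi>)"
      using dN val by force
    show "v = indicator prod_type \<phi>"
      if "\<exists>d\<in>realizations M gs ?q. v = dirac L M p (translate L d \<phi>)" for v
      using that wd[OF _ dN] val by auto
  qed
qed

lemma dirac_prod_type: "dirac L M prod_type = conv L \<kappa> M (dirac L M p) (dirac L M q)"
proof
  fix \<phi>
  show "dirac L M prod_type \<phi> = conv L \<kappa> M (dirac L M p) (dirac L M q) \<phi>"
  proof (cases "\<phi> \<in> fmls_x L M (univ M)")
    case False
    then show ?thesis by (simp add: dirac_def conv_def)
  next
    case True
    note q0 = inv_types_types[OF q]
    define N where "N = (SOME N. conv_model L \<kappa> M (dirac L M p) (dirac L M q) \<phi> N)"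
    have "\<exists>N. conv_model L \<kappa> M (dirac L M p) (dirac L M q) \<phi> N"
      using dirac_star_borel[OF M GM G sig p q0] True unfolding star_borel_def by blast
    then have N: "conv_model L \<kappa> M (dirac L M p) (dirac L M q) \<phi> N"
      unfolding N_def by (rule someI_ex)
    then have NM: "univ N \<subseteq> univ M" using elem_subD(3)[of L N M] unfolding conv_model_def by auto
    let ?X = "type_topology L M (univ N)" and ?q = "q \<inter> fmls_x L M (univ N)"
    let ?\<nu> = "restrict (dirac L M q) (fmls_x L M (univ N))"
    have qN: "?q \<in> types_x L M (univ N)" by (rule types_restrict[OF q0 NM])
    have b: "borel_ext L M (univ N) ?\<nu> = return (borel_of ?X) ?q"
    proof (rule borel_ext_dirac[OF qN])
      show "?\<nu> \<phi> = indicator ?q \<phi>" if "\<phi> \<in> fmls_x L M (univ N)" for \<phi>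
        using that dirac_apply[OF fmls_mono[OF that NM], of q] by (simp add: indicator_def)
    qed
    have "conv L \<kappa> M (dirac L M p) (dirac L M q) \<phi> =
      integral\<^sup>L (restrict_space (borel_ext L M (univ N) ?\<nu>) (support L M (univ N) ?\<nu>)) (conv_fun L M (dirac L M p) \<phi>)"
      using True by (simp add: conv_def Let_def N_def)
    also have "\<dots> = conv_fun L M (dirac L M p) \<phi> ?q"
      unfolding b support_dirac[OF q0 NM] by (rule integral_point_mass[OF closedin_singleton_type[OF qN]])
    also have "\<dots> = indicator prod_type \<phi>" by (rule conv_fun_dirac[OF N])
    finally show ?thesis using dirac_apply[OF True] by simp
  qed
qed

end

theorem proposition3p12:
  fixes L :: "('s, 'f, 'r) lang"
    and T :: "('s, 'f, 'r, 'a) fm set"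
    and \<kappa> :: "'k rel"
    and M G :: "('s, 'f, 'r, 'a) model"
  assumes "T \<subseteq> fmls L M {} []"
    and "monster L T \<kappa> M"
    and "expands_group L M"
    and "elem_sub L G M"
    and "small \<kappa> (univ G)"
  shows "embedding_map
           (subtopology (type_topology L M (univ M)) (inv_types L M G))
           (subtopology (keisler_topology L M (univ M)) (inv_keisler L M G))
           (dirac L M) \<and>
         (\<forall>p \<in> inv_types L M G. \<forall>q \<in> inv_types L M G.
            star_borel L \<kappa> M (dirac L M p) (dirac L M q) \<and>
            (\<forall>(M' :: ('s, 'f, 'r, 'a) model) (\<kappa>' :: 'l rel).
               monster L T \<kappa>' M' \<and> elem_sub L M M' \<and> small \<kappa>' (univ M) \<longrightarrow>
                 type_prod L M M' G p q \<in> inv_types L M G \<and>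
                 dirac L M (type_prod L M M' G p q) = conv L \<kappa> M (dirac L M p) (dirac L M q)))"
proof (intro conjI ballI allI impI)
  show "embedding_map
           (subtopology (type_topology L M (univ M)) (inv_types L M G))
           (subtopology (keisler_topology L M (univ M)) (inv_keisler L M G))
           (dirac L M)"
    by (rule dirac_embedding[OF elem_subD(3)[OF assms(4)]])
  have sig: "has_gmul L" using assms(3) by (simp add: expands_group_def)
  fix p q assume p: "p \<in> inv_types L M G" and q: "q \<in> inv_types L M G"
  show "star_borel L \<kappa> M (dirac L M p) (dirac L M q)"
    by (rule dirac_star_borel[OF assms(2,4,5) sig p inv_types_types[OF q]])
  fix M' :: "('s, 'f, 'r, 'a) model" and \<kappa>' :: "'l rel"
  assume "monster L T \<kappa>' M' \<and> elem_sub L M M' \<and> small \<kappa>' (univ M)"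
  then interpret invariant_product L T \<kappa> M G M' p \<kappa>' q
    using assms p q sig by unfold_locales auto
  show "type_prod L M M' G p q \<in> inv_types L M G"
    unfolding type_prod_eq by (rule prod_type_inv)
  show "dirac L M (type_prod L M M' G p q) = conv L \<kappa> M (dirac L M p) (dirac L M q)"
    unfolding type_prod_eq by (rule dirac_prod_type)
qed

end
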